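(* Let $f(n)$ denote the maximum number of edges in a linear $3$-uniform hypergraph on $n$ vertices which contains no $2$-regular subhypergraph. There is a constant $C$ such that for all integers $n\geq 3$, $$f(n)\leq n\exp\left(C\sqrt{(\log n)(\log\log n)}\right).$$ In particular, every linear $3$-uniform hypergraph with $n$ vertices and at least $n^{1+o(1)}$ edges contains a $2$-regular subhypergraph.
   Context: A hypergraph is linear if any two distinct edges intersect in at most one vertex. A $3$-uniform hypergraph ($3$-graph) has all edges of size $3$. A non-empty hypergraph is $r$-regular if every vertex in it has degree $r$; a subhypergraph is given by a subset of the edges together with the vertices they cover. $\log$ denotes the natural logarithm. *)

theory Defs
  imports Complex_Main
begin

text \<open>A hypergraph is given by a finite vertex set \<open>V\<close> and a set \<open>E\<close> of subsets of \<open>V\<close>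
  (no repeated edges; isolated vertices are allowed).\<close>

definition hypergraph :: "'a set \<Rightarrow> 'a set set \<Rightarrow> bool" where
  "hypergraph V E \<longleftrightarrow> finite V \<and> (\<forall>e\<in>E. e \<subseteq> V)"

definition uniform_edges :: "nat \<Rightarrow> 'a set set \<Rightarrow> bool" where
  "uniform_edges k E \<longleftrightarrow> (\<forall>e\<in>E. card e = k)"

definition linear_edges :: "'a set set \<Rightarrow> bool" where
  "linear_edges E \<longleftrightarrow> (\<forall>e\<in>E. \<forall>e'\<in>E. e \<noteq> e' \<longrightarrow> card (e \<inter> e') \<le> 1)"

definition linear_3graph :: "'a set \<Rightarrow> 'a set set \<Rightarrow> bool" where
  "linear_3graph V E \<longleftrightarrow> hypergraph V E \<and> uniform_edges 3 E \<and> linear_edges E"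

definition vdegree :: "'a set set \<Rightarrow> 'a \<Rightarrow> nat" where
  "vdegree E v = card {e \<in> E. v \<in> e}"

definition regular :: "nat \<Rightarrow> 'a set \<Rightarrow> 'a set set \<Rightarrow> bool" where
  "regular r V E \<longleftrightarrow> E \<noteq> {} \<and> (\<forall>v\<in>V. vdegree E v = r)"

text \<open>A subhypergraph consists of a subset of the edges together with exactly the vertices
  they cover.\<close>

definition has_regular_sub :: "nat \<Rightarrow> 'a set set \<Rightarrow> bool" where
  "has_regular_sub r E \<longleftrightarrow> (\<exists>E'\<subseteq>E. regular r (\<Union>E') E')"

text \<open>Every finite hypergraph is isomorphic to one whose vertices are natural numbers, so
  it suffices to let the maximum range over those.\<close>

definition edge_counts :: "nat \<Rightarrow> nat set" where
  "edge_counts n = {card E | (V :: nat set) E.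
     card V = n \<and> linear_3graph V E \<and> \<not> has_regular_sub 2 E}"

definition max_edges :: "nat \<Rightarrow> nat" where
  "max_edges n = Max (edge_counts n)"

text \<open>The maximum is taken over a finite non-empty set, hence is attained.\<close>

lemma finite_edge_counts: "finite (edge_counts n)"
proof -
  have "edge_counts n \<subseteq> {..2 ^ n}"
  proof
    fix m assume "m \<in> edge_counts n"
    then obtain V :: "nat set" and E where
      *: "m = card E" "card V = n" "finite V" "E \<subseteq> Pow V"
      by (auto simp: edge_counts_def linear_3graph_def hypergraph_def)
    then have "card E \<le> card (Pow V)" by (intro card_mono) auto
    with * show "m \<in> {..2 ^ n}" by (simp add: card_Pow)
  qed
  then show ?thesis using finite_subset by blast
qed

lemma zero_in_edge_counts: "0 \<in> edge_counts n"
proof -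
  have "linear_3graph {..<n} {}" "\<not> has_regular_sub 2 ({} :: nat set set)"
    by (auto simp: linear_3graph_def hypergraph_def uniform_edges_def linear_edges_def
        has_regular_sub_def regular_def)
  then show ?thesis
    unfolding edge_counts_def
    by (intro CollectI exI[of _ "{..<n}"] exI[of _ "{}"]) simp
qed

lemma max_edges_attained: "max_edges n \<in> edge_counts n"
  unfolding max_edges_def using Max_in[OF finite_edge_counts] zero_in_edge_counts by blast

lemma max_edges_upper: "m \<in> edge_counts n \<Longrightarrow> m \<le> max_edges n"
  unfolding max_edges_def by (rule Max_ge[OF finite_edge_counts])

end

theory Submission
  imports Defs "HOL-Analysis.Analysis"
begin

text \<open>Two distinct matchings covering the same vertices have a 2-regular symmetric difference. If
  the degrees are comparable, there are more matchings of a suitable size \<open>r\<close> than possible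
  vertex sets of such matchings, so pigeonhole finishes.

  In general, pigeonholing over dyadic degree classes gives a subhypergraph with parts \<open>A\<close>, \<open>B\<close>,
  \<open>C\<close> in which every part has maximum degree close to its average degree \<open>D\<^sub>A \<ge> D\<^sub>B \<ge> D\<^sub>C\<close>.
  Matchings suffice unless \<open>D\<^sub>A / D\<^sub>B\<close> is large. In that case view the edges as a graph
  between \<open>B\<close> and \<open>C\<close>, properly coloured by \<open>A\<close>, and take many vertex-disjoint rainbow cycles of
  length at most \<open>2 * L\<close>, where \<open>L\<close> is of order \<open>sqrt (ln n / ln (ln n))\<close>, using each colour about
  equally often. Two distinct colour-disjoint subfamilies with the same set of colours have a
  2-regular symmetric difference. As \<open>A\<close> is much smaller than the number of cycles, pigeonhole
  applies again.

  Short rainbow cycles exist because closed walks of length \<open>2 * L\<close> with a repeated colour are few: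
  writing the adjacency matrix as the sum of the matchings of the colours, their number is
  bounded through convexity of \<open>p \<mapsto> (\<Sum>c. tr (M\<^sub>c A\<^sup>p M\<^sub>c A\<^sup>q))\<close> for \<open>p + q = 2 * L - 2\<close>.\<close>

section \<open>Rainbow cycles in properly coloured graphs\<close>

text \<open>The bound balances two demands on the smallest degree d of the three parts. Finding
  rainbow cycles of length at most 2 L needs (d / polylog)^L > n^2, so d of order at least exp(2 ln
  n / L). The pigeonhole for r cycles out of s compares about (s / r)^r families with at most about
  (|A| / (L r))^(2 L r) colour sets. Greedy packing gives s of order |E| / (L \<open>DB\<close>),
  and |A| is at most \<Lambda> |E| / \<open>DA\<close> with \<Lambda> polylogarithmic, so the
  families win once \<open>DA\<close> / \<open>DB\<close> exceeds (const L \<Lambda>)^(2 L).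
  Matchings of size about |E| / \<open>DA\<close> win once \<open>DB\<close> \<open>DC\<close>
  exceeds const \<Lambda>^3 \<open>DA\<close>. The two cases overlap when d is larger than const
  \<Lambda>^3 (const L \<Lambda>)^(2 L), which is exp(O(L ln ln n)). Equating this with exp(2 ln n /
  L) gives the order of L, and both demands become exp(O(sqrt(ln n ln ln n))). A rainbow cycle alone
  is not 2-regular because its colours have degree one. Hence many cycles meeting only in colours
  are needed, and no colour may be used too often: the usage of the colours of a cycle bounds how
  many other cycles it meets.\<close>

locale coloured_graph =
  fixes S :: "'v set" and K :: "'c set" and adj :: "'c \<Rightarrow> 'v \<Rightarrow> 'v \<Rightarrow> bool" and D :: real
  assumes finite_S: "finite S" and finite_K: "finite K"
    and adj_sym: "adj c x y \<Longrightarrow> adj c y x"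
    and adj_S: "adj c x y \<Longrightarrow> x \<in> S"
    and adj_proper: "adj c x y \<Longrightarrow> adj c x z \<Longrightarrow> y = z"
    and adj_degree: "x \<in> S \<Longrightarrow> (\<Sum>c\<in>K. \<Sum>y\<in>S. of_bool (adj c x y)) \<le> D"
begin

section \<open>Matrices indexed by \<open>S\<close>, their trace and inner product\<close>

definition mul :: "('v \<Rightarrow> 'v \<Rightarrow> real) \<Rightarrow> ('v \<Rightarrow> 'v \<Rightarrow> real) \<Rightarrow> 'v \<Rightarrow> 'v \<Rightarrow> real"  (infixr "\<odot>" 70)
  where "(X \<odot> Y) x y = (\<Sum>z\<in>S. X x z * Y z y)"

definition one :: "'v \<Rightarrow> 'v \<Rightarrow> real" where "one x y = of_bool (x = y \<and> x \<in> S)"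

text \<open>Matrices are plain functions, and \<open>one\<close> vanishes outside \<open>S\<close>,
  so the unit laws hold only for matrices that vanish outside \<open>S\<close> as well.\<close>

definition supported :: "('v \<Rightarrow> 'v \<Rightarrow> real) \<Rightarrow> bool"
  where "supported X \<longleftrightarrow> (\<forall>x y. X x y \<noteq> 0 \<longrightarrow> x \<in> S \<and> y \<in> S)"

definition transp :: "('v \<Rightarrow> 'v \<Rightarrow> real) \<Rightarrow> 'v \<Rightarrow> 'v \<Rightarrow> real" where "transp X x y = X y x"

definition trace :: "('v \<Rightarrow> 'v \<Rightarrow> real) \<Rightarrow> real" where "trace X = (\<Sum>x\<in>S. X x x)"

text \<open>The Frobenius inner product.\<close>

definition ip :: "('v \<Rightarrow> 'v \<Rightarrow> real) \<Rightarrow> ('v \<Rightarrow> 'v \<Rightarrow> real) \<Rightarrow> real"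
  where "ip X Y = (\<Sum>x\<in>S. \<Sum>y\<in>S. X x y * Y x y)"

definition M :: "'c \<Rightarrow> 'v \<Rightarrow> 'v \<Rightarrow> real" where "M c x y = of_bool (adj c x y)"

definition Adj :: "'v \<Rightarrow> 'v \<Rightarrow> real" where "Adj x y = (\<Sum>c\<in>K. M c x y)"

primrec pw :: "nat \<Rightarrow> 'v \<Rightarrow> 'v \<Rightarrow> real" where
  "pw 0 = one"
| "pw (Suc n) = Adj \<odot> pw n"

lemma mul_assoc: "(X \<odot> Y) \<odot> Z = X \<odot> (Y \<odot> Z)"
proof (intro ext)
  fix x y
  have "((X \<odot> Y) \<odot> Z) x y = (\<Sum>w\<in>S. \<Sum>z\<in>S. X x z * Y z w * Z w y)"
    by (simp add: mul_def sum_distrib_right)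
  also have "\<dots> = (\<Sum>z\<in>S. \<Sum>w\<in>S. X x z * Y z w * Z w y)" by (rule sum.swap)
  also have "\<dots> = (X \<odot> (Y \<odot> Z)) x y"
    by (simp add: mul_def sum_distrib_left mult.assoc)
  finally show "((X \<odot> Y) \<odot> Z) x y = (X \<odot> (Y \<odot> Z)) x y" .
qed

lemma one_mul: assumes "supported X" shows "one \<odot> X = X"
proof (intro ext)
  fix x y
  have "(one \<odot> X) x y = (\<Sum>z\<in>S. if z = x then (if x \<in> S then X x y else 0) else 0)"
    unfolding mul_def one_def by (intro sum.cong) auto
  also have "\<dots> = X x y" using assms finite_S by (auto simp: supported_def)
  finally show "(one \<odot> X) x y = X x y" .
qed

lemma transp_mul: "transp (X \<odot> Y) = transp Y \<odot> transp X"
  by (intro ext) (simp add: transp_def mul_def mult.commute)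

lemma transp_one: "transp one = one"
  by (intro ext) (auto simp: transp_def one_def)

lemma transp_transp [simp]: "transp (transp X) = X"
  by (intro ext) (simp add: transp_def)

lemma supported_transp: "supported X \<Longrightarrow> supported (transp X)"
  by (auto simp: supported_def transp_def)

lemma mul_one: assumes "supported X" shows "X \<odot> one = X"
  using one_mul[OF supported_transp[OF assms]] transp_mul[of X one] transp_one
  by (metis transp_transp)

lemma supported_mul: assumes "supported X" "supported Y" shows "supported (X \<odot> Y)"
  unfolding supported_def
proof (intro allI impI)
  fix x y assume "(X \<odot> Y) x y \<noteq> 0"
  then obtain z where "X x z * Y z y \<noteq> 0"
    unfolding mul_def by (meson sum.not_neutral_contains_not_neutral)
  then show "x \<in> S \<and> y \<in> S" using assms by (auto simp: supported_def)
qed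

lemma supported_one: "supported one" by (auto simp: supported_def one_def)

lemma supported_M: "supported (M c)"
  using adj_S adj_sym by (auto simp: supported_def M_def) blast

lemma supported_Adj: "supported Adj"
  unfolding supported_def
proof (intro allI impI)
  fix x y assume "Adj x y \<noteq> 0"
  then obtain c where "M c x y \<noteq> 0"
    unfolding Adj_def by (meson sum.not_neutral_contains_not_neutral)
  then show "x \<in> S \<and> y \<in> S" using supported_M by (auto simp: supported_def)
qed

lemma supported_pw: "supported (pw n)"
  by (induction n) (auto intro: supported_one supported_Adj supported_mul)

lemma pw_add: "pw m \<odot> pw n = pw (m + n)"
  by (induction m) (simp_all add: one_mul supported_pw mul_assoc)

lemma pw_one: "pw 1 = Adj"
  by (simp add: mul_one supported_Adj)

lemma transp_M: "transp (M c) = M c"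
  using adj_sym by (intro ext) (auto simp: transp_def M_def)

lemma transp_Adj: "transp Adj = Adj"
proof (intro ext)
  fix x y
  have "M c y x = M c x y" for c using transp_M[of c] by (metis transp_def)
  then show "transp Adj x y = Adj x y" by (simp add: transp_def Adj_def)
qed

lemma transp_pw: "transp (pw n) = pw n"
proof (induction n)
  case (Suc n)
  have "transp (pw (Suc n)) = pw n \<odot> Adj"
    using Suc by (simp add: transp_mul transp_Adj)
  then show ?case by (metis pw_add pw_one Suc_eq_plus1)
qed (simp add: transp_one)

lemma trace_comm: "trace (X \<odot> Y) = trace (Y \<odot> X)"
  unfolding trace_def mul_def by (subst sum.swap) (simp add: mult.commute)

lemma ip_trace: "ip X Y = trace (X \<odot> transp Y)"
  by (simp add: ip_def trace_def mul_def transp_def)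

lemma ip_amgm: "ip X Y \<le> (ip X X + ip Y Y) / 2"
proof -
  have *: "X x y * Y x y \<le> (X x y * X x y + Y x y * Y x y) / 2" for x y
    using sum_squares_bound[of "X x y" "Y x y"] by (simp add: power2_eq_square)
  have "ip X Y \<le> (\<Sum>x\<in>S. \<Sum>y\<in>S. (X x y * X x y + Y x y * Y x y) / 2)"
    unfolding ip_def by (intro sum_mono *)
  also have "\<dots> = (ip X X + ip Y Y) / 2"
    by (simp add: ip_def sum.distrib flip: sum_divide_distrib)
  finally show ?thesis .
qed

lemma ip_Cauchy_Schwarz: "(ip X Y)\<^sup>2 \<le> ip X X * ip Y Y"
  using Cauchy_Schwarz_ineq_sum[of "\<lambda>(x, y). X x y" "\<lambda>(x, y). Y x y" "S \<times> S"]
  by (simp add: ip_def sum.cartesian_product case_prod_unfold power2_eq_square)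

text \<open>The squared Frobenius norm of the n-th power of the adjacency matrix; as the matrix is
  symmetric, this is the number of closed walks of length 2 n, coloured steps being counted with
  their colours.\<close>

definition w :: "nat \<Rightarrow> real" where "w n = ip (pw n) (pw n)"

lemma ip_pw: "ip (pw a) (pw b) = trace (pw (a + b))"
  by (simp add: ip_trace transp_pw pw_add)

lemma w_trace: "w n = trace (pw (2 * n))"
  by (simp add: w_def ip_pw mult_2)

text \<open>Cauchy-Schwarz for the powers n and n + 2, whose inner product is the trace of the power
  2 n + 2.\<close>

lemma w_log_convex: "(w (Suc n))\<^sup>2 \<le> w n * w (Suc (Suc n))"
proof -
  have "w (Suc n) = ip (pw n) (pw (Suc (Suc n)))"
    unfolding w_def ip_pw by (metis add_Suc_shift)
  then show ?thesis using ip_Cauchy_Schwarz[of "pw n" "pw (Suc (Suc n))"] by (simp add: w_def)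
qed

lemma w_0: "w 0 = card S"
proof -
  have "(\<Sum>x\<in>S. \<Sum>y\<in>S. one x y * one x y) = (\<Sum>x\<in>S. \<Sum>y\<in>S. if y = x then 1 else 0)"
    by (intro sum.cong) (auto simp: one_def)
  then show ?thesis using finite_S by (simp add: w_def ip_def)
qed

lemma w_nonneg: "w n \<ge> 0"
  unfolding w_def ip_def by (intro sum_nonneg) simp

section \<open>Closed walks with a repeated colour\<close>

text \<open>Counts closed walks of length p + q + 2 with two marked steps of the same colour,
  separated by p steps on one side and by q steps on the other.\<close>

definition conflict :: "nat \<Rightarrow> nat \<Rightarrow> real"
  where "conflict p q = (\<Sum>c\<in>K. trace (M c \<odot> pw p \<odot> M c \<odot> pw q))"

text \<open>Symmetry of all factors and cyclicity of the trace: gluing two open walks at both ends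
  joins their outer and inner stretches.\<close>

lemma ip_split:
  "ip (pw s \<odot> M c \<odot> pw r) (pw s' \<odot> M c \<odot> pw r')
     = trace (M c \<odot> pw (r + r') \<odot> M c \<odot> pw (s + s'))"
proof -
  have "ip (pw s \<odot> M c \<odot> pw r) (pw s' \<odot> M c \<odot> pw r')
      = trace (pw s \<odot> (M c \<odot> pw r \<odot> pw r' \<odot> M c \<odot> pw s'))"
    by (simp add: ip_trace transp_mul transp_pw transp_M mul_assoc)
  also have "\<dots> = trace ((M c \<odot> pw r \<odot> pw r' \<odot> M c \<odot> pw s') \<odot> pw s)"
    by (rule trace_comm)
  also have "\<dots> = trace (M c \<odot> (pw r \<odot> pw r') \<odot> M c \<odot> (pw s' \<odot> pw s))"
    by (simp add: mul_assoc)
  finally show ?thesis by (simp add: pw_add add.commute)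
qed

text \<open>By the trace identity above, both sides consist of inner products of matrices
  \<open>A\<^sup>s M\<^sub>c A\<^sup>r\<close>, so this is the inequality of arithmetic and geometric means.\<close>

lemma conflict_mid:
  "conflict (r + r') (s + s') \<le> (conflict (2 * r) (2 * s) + conflict (2 * r') (2 * s')) / 2"
proof -
  have "conflict (r + r') (s + s')
      = (\<Sum>c\<in>K. ip (pw s \<odot> M c \<odot> pw r) (pw s' \<odot> M c \<odot> pw r'))"
    by (simp add: conflict_def ip_split)
  also have "\<dots> \<le> (\<Sum>c\<in>K. (ip (pw s \<odot> M c \<odot> pw r) (pw s \<odot> M c \<odot> pw r)
      + ip (pw s' \<odot> M c \<odot> pw r') (pw s' \<odot> M c \<odot> pw r')) / 2)"
    by (intro sum_mono ip_amgm)
  also have "\<dots> = (conflict (2 * r) (2 * s) + conflict (2 * r') (2 * s')) / 2"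
    by (simp add: conflict_def ip_split sum.distrib mult_2 flip: sum_divide_distrib)
  finally show ?thesis .
qed

lemma conflict_comm: "conflict p q = conflict q p"
proof -
  have "trace (M c \<odot> pw p \<odot> M c \<odot> pw q) = trace (M c \<odot> pw q \<odot> M c \<odot> pw p)" for c
    using trace_comm[of "M c \<odot> pw p" "M c \<odot> pw q"] by (simp add: mul_assoc)
  then show ?thesis by (simp add: conflict_def)
qed

text \<open>A colour class is a matching, so row x of \<open>M c\<close> has at most one nonzero
  entry, which is 1. The sum on the left thus has at most one term and squaring it loses no
  factor.\<close>

lemma M_row_square: "((M c \<odot> Y) x y)\<^sup>2 \<le> (\<Sum>z\<in>S. M c x z * (Y z y)\<^sup>2)"
proof (cases "\<exists>z\<in>S. adj c x z")
  case True
  then obtain z where z: "z \<in> S" "adj c x z" by blast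
  have M: "M c x z' = (if z' = z then 1 else 0)" for z'
    using z adj_proper[of c x] by (auto simp: M_def)
  have *: "(\<Sum>z'\<in>S. M c x z' * f z') = f z" for f
  proof -
    have "(\<Sum>z'\<in>S. M c x z' * f z') = (\<Sum>z'\<in>S. if z' = z then f z' else 0)"
      by (intro sum.cong) (auto simp: M)
    then show ?thesis using z finite_S by simp
  qed
  show ?thesis unfolding mul_def * by simp
next
  case False
  then have "(M c \<odot> Y) x y = 0" unfolding mul_def by (intro sum.neutral) (auto simp: M_def)
  then show ?thesis by (simp add: sum_nonneg M_def)
qed

text \<open>With q = 0 the two marked steps are adjacent and the count is the sum over c of the
  squared norms of \<open>M c \<odot> pw n\<close>. There each row z of \<open>pw n\<close> is used
  at most once per coloured edge at z, hence at most \<open>D\<close> times.\<close>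

lemma conflict_end: "conflict (2 * n) 0 \<le> D * w n"
proof -
  have "conflict (2 * n) 0 = (\<Sum>c\<in>K. ip (M c \<odot> pw n) (M c \<odot> pw n))"
    unfolding conflict_def
  proof (intro sum.cong refl)
    fix c
    show "trace (M c \<odot> pw (2 * n) \<odot> M c \<odot> pw 0) = ip (M c \<odot> pw n) (M c \<odot> pw n)"
      using ip_split[of 0 c n 0 n] by (simp add: one_mul supported_mul supported_M supported_pw mult_2)
  qed
  also have "\<dots> \<le> (\<Sum>c\<in>K. \<Sum>x\<in>S. \<Sum>y\<in>S. \<Sum>z\<in>S. M c x z * (pw n z y)\<^sup>2)"
    unfolding ip_def using M_row_square by (intro sum_mono) (simp add: power2_eq_square)
  \<comment> \<open>The vertex z is moved outermost so that its degree splits off as a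
    factor.\<close>
  also have "\<dots> = (\<Sum>c\<in>K. \<Sum>z\<in>S. \<Sum>x\<in>S. \<Sum>y\<in>S. M c x z * (pw n z y)\<^sup>2)"
  proof (rule sum.cong, rule refl)
    fix c
    have "(\<Sum>x\<in>S. \<Sum>y\<in>S. \<Sum>z\<in>S. M c x z * (pw n z y)\<^sup>2)
        = (\<Sum>x\<in>S. \<Sum>z\<in>S. \<Sum>y\<in>S. M c x z * (pw n z y)\<^sup>2)"
      by (intro sum.cong refl sum.swap)
    also have "\<dots> = (\<Sum>z\<in>S. \<Sum>x\<in>S. \<Sum>y\<in>S. M c x z * (pw n z y)\<^sup>2)"
      by (rule sum.swap)
    finally show "(\<Sum>x\<in>S. \<Sum>y\<in>S. \<Sum>z\<in>S. M c x z * (pw n z y)\<^sup>2)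
        = (\<Sum>z\<in>S. \<Sum>x\<in>S. \<Sum>y\<in>S. M c x z * (pw n z y)\<^sup>2)" .
  qed
  also have "\<dots> = (\<Sum>z\<in>S. \<Sum>c\<in>K. \<Sum>x\<in>S. \<Sum>y\<in>S. M c x z * (pw n z y)\<^sup>2)"
    by (rule sum.swap)
  also have "\<dots> = (\<Sum>z\<in>S. (\<Sum>c\<in>K. \<Sum>x\<in>S. M c z x) * (\<Sum>y\<in>S. (pw n z y)\<^sup>2))"
  proof (intro sum.cong refl)
    fix z
    have "M c x z = M c z x" for c x using transp_M[of c] by (metis transp_def)
    then show "(\<Sum>c\<in>K. \<Sum>x\<in>S. \<Sum>y\<in>S. M c x z * (pw n z y)\<^sup>2)
        = (\<Sum>c\<in>K. \<Sum>x\<in>S. M c z x) * (\<Sum>y\<in>S. (pw n z y)\<^sup>2)"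
      by (simp add: sum_distrib_right flip: sum_distrib_left)
  qed
  also have "\<dots> \<le> (\<Sum>z\<in>S. D * (\<Sum>y\<in>S. (pw n z y)\<^sup>2))"
    using adj_degree by (intro sum_mono mult_right_mono) (auto simp: M_def intro: sum_nonneg)
  also have "\<dots> = D * w n"
    by (simp add: w_def ip_def sum_distrib_left power2_eq_square)
  finally show ?thesis .
qed

end

text \<open>If the maximum exceeded the common end value, the leftmost index attaining it would be
  interior, with a strictly smaller left neighbour and a right neighbour that is no larger. This
  contradicts the midpoint inequality.\<close>

lemma midpoint_convex_le_max:
  fixes v :: "nat \<Rightarrow> real"
  assumes mid: "\<And>r. 0 < r \<Longrightarrow> r < n \<Longrightarrow> v r \<le> (v (r - 1) + v (r + 1)) / 2"
    and "v n = v 0" "r \<le> n"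
  shows "v r \<le> v 0"
proof (rule ccontr)
  assume "\<not> v r \<le> v 0"
  define m where "m = Max (v ` {..n})"
  have le: "v i \<le> m" if "i \<le> n" for i unfolding m_def using that by (intro Max_ge) auto
  have "m \<in> v ` {..n}" unfolding m_def by (intro Max_in) auto
  then have ne: "{i. i \<le> n \<and> v i = m} \<noteq> {}" by auto
  define i where "i = Min {i. i \<le> n \<and> v i = m}"
  have "i \<in> {i. i \<le> n \<and> v i = m}" unfolding i_def using ne by (intro Min_in) auto
  then have i: "i \<le> n" "v i = m" by auto
  have "v 0 < m" using \<open>\<not> v r \<le> v 0\<close> le[OF \<open>r \<le> n\<close>] by simp
  then have "i \<noteq> 0" "i \<noteq> n" using i assms(2) by (metis order_less_irrefl)+
  then have "v i \<le> (v (i - 1) + v (i + 1)) / 2" "v (i + 1) \<le> m"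
    using mid[of i] le i(1) by auto
  moreover have "v (i - 1) < m"
  proof -
    have "v (i - 1) \<noteq> m"
    proof
      assume "v (i - 1) = m"
      then have "i - 1 \<in> {i. i \<le> n \<and> v i = m}" using i by auto
      then have "i \<le> i - 1" unfolding i_def by (intro Min_le) auto
      then show False using \<open>i \<noteq> 0\<close> by simp
    qed
    then show ?thesis using le[of "i - 1"] i(1) by (simp add: less_le)
  qed
  ultimately show False using i(2) by simp
qed

context coloured_graph begin

text \<open>Along even exponents with fixed sum the counts are midpoint convex and symmetric, so the
  ends, where one exponent is 0, dominate.\<close>

lemma conflict_even: assumes "r + s = n" shows "conflict (2 * r) (2 * s) \<le> D * w n"
proof -
  define v where "v r = conflict (2 * r) (2 * (n - r))" for r
  have "v r \<le> v 0"
  proof (rule midpoint_convex_le_max)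
    fix r assume r: "0 < r" "r < n"
    have "conflict ((r - 1) + (r + 1)) ((n - (r - 1)) + (n - (r + 1)))
      \<le> (conflict (2 * (r - 1)) (2 * (n - (r - 1)))
          + conflict (2 * (r + 1)) (2 * (n - (r + 1)))) / 2"
      by (rule conflict_mid)
    moreover have "(r - 1) + (r + 1) = 2 * r" "(n - (r - 1)) + (n - (r + 1)) = 2 * (n - r)"
      using r by auto
    ultimately show "v r \<le> (v (r - 1) + v (r + 1)) / 2" unfolding v_def by metis
  next
    show "v n = v 0" using conflict_comm[of "2 * n" 0] by (simp add: v_def)
  qed (use assms in auto)
  moreover have "v 0 \<le> D * w n"
    using conflict_end[of n] conflict_comm[of "2 * n" 0] by (simp add: v_def)
  moreover have "n - r = s" using assms by auto
  ultimately show ?thesis by (simp add: v_def)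
qed

text \<open>Odd exponents are midpoints of neighbouring even ones, so one more use of
  \<open>conflict_mid\<close> reduces them to the even case.\<close>

lemma conflict_le: assumes "p + q = 2 * n" shows "conflict p q \<le> D * w n"
proof (cases "even p")
  case True
  then obtain r where r: "p = 2 * r" by blast
  then obtain s where "q = 2 * s" using assms by (metis dvd_add_right_iff dvd_triv_left evenE)
  then show ?thesis using conflict_even[of r s n] assms r by simp
next
  case False
  then obtain r where r: "p = r + Suc r" by (metis add_Suc_right mult_2 oddE Suc_eq_plus1)
  have "odd q" using False assms by (metis dvd_triv_left even_add)
  then obtain s where s: "q = Suc s + s" by (metis add_Suc mult_2 oddE Suc_eq_plus1)
  have "conflict p q \<le> (conflict (2 * r) (2 * Suc s) + conflict (2 * Suc r) (2 * s)) / 2"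
    unfolding r s by (rule conflict_mid)
  moreover have "conflict (2 * r) (2 * Suc s) \<le> D * w n" "conflict (2 * Suc r) (2 * s) \<le> D * w n"
    using assms r s by (intro conflict_even; simp)+
  ultimately show ?thesis by simp
qed

end

section \<open>Walks as lists of coloured steps\<close>

text \<open>A step records its colour and its end vertex. For a nonempty closed walk
  \<open>map snd\<close> lists each visit once, the start appearing as the last entry, so
  distinctness of \<open>map snd\<close> says that the walk is a cycle.\<close>

fun walk :: "('c \<Rightarrow> 'v \<Rightarrow> 'v \<Rightarrow> bool) \<Rightarrow> 'v \<Rightarrow> ('c \<times> 'v) list \<Rightarrow> 'v \<Rightarrow> bool" where
  "walk adj x [] y \<longleftrightarrow> x = y"
| "walk adj x ((c, z) # ps) y \<longleftrightarrow> adj c x z \<and> walk adj z ps y"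

lemma walk_append: "walk adj x (ps @ qs) y \<longleftrightarrow> (\<exists>z. walk adj x ps z \<and> walk adj z qs y)"
  by (induction ps arbitrary: x) auto

text \<open>Between two visits to the same vertex lies a shorter closed walk, whose colours are
  still distinct.\<close>

lemma shortest_rainbow_cycle:
  assumes "walk adj x ps x" "ps \<noteq> []" "distinct (map fst ps)"
  shows "\<exists>x' ps'. walk adj x' ps' x' \<and> ps' \<noteq> [] \<and> distinct (map fst ps') \<and> distinct (map snd ps')
    \<and> set (map fst ps') \<subseteq> set (map fst ps) \<and> length ps' \<le> length ps"
  using assms
proof (induction "length ps" arbitrary: x ps rule: less_induct)
  case less
  show ?case
  proof (cases "distinct (map snd ps)")
    case True
    then show ?thesis using less.prems by blast
  next
    case False
    then obtain us vs ws z where "map snd ps = us @ [z] @ vs @ [z] @ ws"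
      using not_distinct_decomp by blast
    then obtain us' vs' ws' c c' where ps: "ps = us' @ [(c, z)] @ vs' @ [(c', z)] @ ws'"
      by (auto simp: map_eq_append_conv map_eq_Cons_conv append_eq_map_conv Cons_eq_map_conv)
    \<comment> \<open>The step entering z for the first time is dropped and the one entering it for
      the second time is kept, so the segment starts and ends at z.\<close>
    have "walk adj z (vs' @ [(c', z)]) z"
      using less.prems(1) unfolding ps walk_append by auto
    moreover have "distinct (map fst (vs' @ [(c', z)]))" using less.prems(3) ps by auto
    moreover have "length (vs' @ [(c', z)]) < length ps" using ps by simp
    ultimately obtain x' ps' where "walk adj x' ps' x'" "ps' \<noteq> []" "distinct (map fst ps')"
      "distinct (map snd ps')" "set (map fst ps') \<subseteq> set (map fst (vs' @ [(c', z)]))"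
      "length ps' \<le> length (vs' @ [(c', z)])"
      using less.hyps[of "vs' @ [(c', z)]" z] by blast
    moreover have "set (map fst (vs' @ [(c', z)])) \<subseteq> set (map fst ps)" using ps by auto
    moreover have "length (vs' @ [(c', z)]) \<le> length ps" using ps by simp
    ultimately show ?thesis by (meson order_trans)
  qed
qed

context coloured_graph begin

text \<open>Log-convexity pushes an upper bound on the last ratio of consecutive terms back to all
  earlier ones.\<close>

lemma w_le_geometric:
  assumes "w (Suc n) \<le> \<kappa> * w n" "\<kappa> \<ge> 0" "m \<le> Suc n"
  shows "w m \<le> \<kappa> ^ m * w 0"
proof -
  have ratio: "w (Suc k) \<le> \<kappa> * w k" if "k \<le> n" for k
    using that
  proof (induction k rule: inc_induct)
    case (step k)
    show ?case
    proof (cases "w (Suc k) = 0")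
      case True
      then show ?thesis using assms(2) w_nonneg[of k] by simp
    next
      case False
      have "w (Suc k) * w (Suc k) \<le> w k * w (Suc (Suc k))"
        using w_log_convex[of k] by (simp add: power2_eq_square)
      also have "\<dots> \<le> w k * (\<kappa> * w (Suc k))"
        using step by (intro mult_left_mono w_nonneg) auto
      finally have "w (Suc k) * w (Suc k) \<le> (\<kappa> * w k) * w (Suc k)" by (simp add: mult_ac)
      then show ?thesis using False w_nonneg[of "Suc k"] by (auto simp: mult_le_cancel_right)
    qed
  qed (use assms in simp)
  show ?thesis using assms(3)
  proof (induction m)
    case (Suc m)
    have "w (Suc m) \<le> \<kappa> * w m" using Suc.prems by (intro ratio) simp
    also have "\<dots> \<le> \<kappa> * (\<kappa> ^ m * w 0)" using Suc assms(2) by (intro mult_left_mono) auto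
    finally show ?case by simp
  qed simp
qed

section \<open>Expanding matrix powers into colour sequences\<close>

text \<open>Since colour classes are matchings, entry (x, y) for x in \<open>S\<close> is 1 if
  following the colours \<open>cs\<close> from x is possible and leads to y, and 0
  otherwise.\<close>

definition word :: "'c list \<Rightarrow> 'v \<Rightarrow> 'v \<Rightarrow> real"
  where "word cs = foldr (\<lambda>c X. M c \<odot> X) cs one"

lemma word_Nil: "word [] = one" and word_Cons: "word (c # cs) = M c \<odot> word cs"
  by (simp_all add: word_def)

lemma supported_word: "supported (word cs)"
  by (induction cs) (auto simp: word_Nil word_Cons intro: supported_one supported_M supported_mul)

lemma word_append: "word (us @ vs) = word us \<odot> word vs"
  by (induction us) (simp_all add: word_Nil word_Cons one_mul supported_word mul_assoc)

lemma word_nonneg: "word cs x y \<ge> 0"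
proof (induction cs arbitrary: x y)
  case (Cons c cs)
  then show ?case unfolding word_Cons mul_def by (intro sum_nonneg) (simp add: M_def)
qed (simp add: word_Nil one_def)

lemma walk_of_word: "word cs x y \<noteq> 0 \<Longrightarrow> \<exists>ps. map fst ps = cs \<and> walk adj x ps y"
proof (induction cs arbitrary: x)
  case Nil
  then show ?case by (auto simp: word_Nil one_def)
next
  case (Cons c cs)
  then obtain z where "M c x z * word cs z y \<noteq> 0"
    unfolding word_Cons mul_def by (meson sum.not_neutral_contains_not_neutral)
  then have "adj c x z" "word cs z y \<noteq> 0" by (auto simp: M_def)
  with Cons.IH obtain ps where "map fst ps = cs" "walk adj z ps y" by blast
  with \<open>adj c x z\<close> show ?case by (intro exI[of _ "(c, z) # ps"]) auto
qed

definition words :: "nat \<Rightarrow> 'c list set" where "words n = {cs. set cs \<subseteq> K \<and> length cs = n}"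

lemma finite_words: "finite (words n)"
  unfolding words_def by (intro finite_lists_length_eq finite_K)

definition msum :: "'i set \<Rightarrow> ('i \<Rightarrow> 'v \<Rightarrow> 'v \<Rightarrow> real) \<Rightarrow> 'v \<Rightarrow> 'v \<Rightarrow> real"
  where "msum I X x y = (\<Sum>i\<in>I. X i x y)"

lemma msum_mul: "msum I (\<lambda>i. X i \<odot> Y) = msum I X \<odot> Y"
  by (intro ext) (simp add: mul_def msum_def sum_distrib_right sum.swap[of _ S I])

lemma mul_msum: "msum I (\<lambda>i. X \<odot> Y i) = X \<odot> msum I Y"
  by (intro ext) (simp add: mul_def msum_def sum_distrib_left sum.swap[of _ S I])

lemma trace_msum: "trace (msum I X) = (\<Sum>i\<in>I. trace (X i))"
  unfolding trace_def msum_def by (rule sum.swap)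

text \<open>Multiplies out the n-th power of the sum of the \<open>M c\<close>; traces of powers can
  then be split by whether the colour sequence is distinct.\<close>

lemma msum_words: "msum (words n) word = pw n"
proof (induction n)
  case 0
  have "words 0 = {[]}" by (auto simp: words_def)
  then show ?case by (intro ext) (simp add: word_Nil msum_def)
next
  case (Suc n)
  have img: "words (Suc n) = (\<lambda>(c, cs). c # cs) ` (K \<times> words n)"
    by (auto simp: words_def length_Suc_conv)
  have "msum (words (Suc n)) word = msum K (\<lambda>c. msum (words n) (\<lambda>cs. M c \<odot> word cs))"
    unfolding img msum_def
    by (intro ext, subst sum.reindex)
      (auto simp: inj_on_def word_Cons case_prod_unfold sum.cartesian_product)
  also have "\<dots> = msum K M \<odot> msum (words n) word"
    by (simp add: msum_mul mul_msum)
  also have "msum K M = Adj" by (intro ext) (simp add: Adj_def msum_def)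
  finally show ?case using Suc by simp
qed

lemma trace_word_nonneg: "trace (word cs) \<ge> 0"
  unfolding trace_def by (intro sum_nonneg word_nonneg)

text \<open>Cyclicity of the trace moves the prefix behind the suffix, so only the gap p and the
  remaining length k + i matter.\<close>

lemma sum_repeated:
  "(\<Sum>us\<in>words i. \<Sum>c\<in>K. \<Sum>vs\<in>words p. \<Sum>ws\<in>words k. trace (word (us @ [c] @ vs @ [c] @ ws)))
     = conflict p (k + i)"
proof -
  have "(\<Sum>us\<in>words i. \<Sum>c\<in>K. \<Sum>vs\<in>words p. \<Sum>ws\<in>words k. trace (word (us @ [c] @ vs @ [c] @ ws)))
      = (\<Sum>c\<in>K. trace (pw i \<odot> M c \<odot> pw p \<odot> M c \<odot> pw k))"
    apply (subst sum.swap)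
    apply (simp add: word_append word_Cons word_Nil mul_assoc one_mul supported_word)
    apply (simp add: msum_mul mul_msum msum_words flip: trace_msum)
    done
  also have "\<dots> = (\<Sum>c\<in>K. trace (M c \<odot> pw p \<odot> M c \<odot> pw (k + i)))"
  proof (rule sum.cong, rule refl)
    fix c
    show "trace (pw i \<odot> M c \<odot> pw p \<odot> M c \<odot> pw k) = trace (M c \<odot> pw p \<odot> M c \<odot> pw (k + i))"
      using trace_comm[of "pw i" "M c \<odot> pw p \<odot> M c \<odot> pw k"] by (simp add: mul_assoc pw_add)
  qed
  finally show ?thesis by (simp add: conflict_def)
qed

text \<open>Union bound over the positions of a repeated pair of colours; each choice of positions
  contributes at most \<open>D * w n\<close> by \<open>conflict_le\<close>.\<close>

lemma sum_non_distinct: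
  "(\<Sum>cs | cs \<in> words (2 * n + 2) \<and> \<not> distinct cs. trace (word cs)) \<le> (2 * n + 2)\<^sup>2 * (D * w n)"
proof -
  \<comment> \<open>The pairs are the prefix length and the gap between the two equal colours; they
    determine the suffix length.\<close>
  define I where "I = {(i, p). i + p \<le> 2 * n}"
  have I_sub: "I \<subseteq> {..<2 * n + 2} \<times> {..<2 * n + 2}" by (auto simp: I_def)
  then have finI: "finite I" by (rule finite_subset) auto
  have "card I \<le> card ({..<2 * n + 2} \<times> {..<2 * n + 2})" using I_sub by (intro card_mono) auto
  then have cardI: "card I \<le> (2 * n + 2)\<^sup>2" by (simp add: power2_eq_square)
  define T where "T = (SIGMA ip:I. words (fst ip) \<times> K \<times> words (snd ip) \<times> words (2 * n - fst ip - snd ip))"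
  define f where "f = (\<lambda>(ip :: nat \<times> nat, us, c :: 'c, vs, ws). us @ [c] @ vs @ [c] @ ws)"
  have finT: "finite T" unfolding T_def
    using finI finite_K by (intro finite_SigmaI finite_cartesian_product finite_words) auto
  have "{cs. cs \<in> words (2 * n + 2) \<and> \<not> distinct cs} \<subseteq> f ` T"
  proof
    fix cs assume "cs \<in> {cs. cs \<in> words (2 * n + 2) \<and> \<not> distinct cs}"
    then have cs: "set cs \<subseteq> K" "length cs = 2 * n + 2" "\<not> distinct cs" by (auto simp: words_def)
    then obtain us c vs ws where dec: "cs = us @ [c] @ vs @ [c] @ ws"
      using not_distinct_decomp by blast
    then have "((length us, length vs), us, c, vs, ws) \<in> T"
      using cs by (auto simp: T_def I_def words_def)
    then show "cs \<in> f ` T" using dec by (force simp: f_def)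
  qed
  then have "(\<Sum>cs | cs \<in> words (2 * n + 2) \<and> \<not> distinct cs. trace (word cs))
      \<le> (\<Sum>cs\<in>f ` T. trace (word cs))"
    using finT by (intro sum_mono2) (auto intro: trace_word_nonneg)
  \<comment> \<open>A sequence may have several decompositions. All traces are nonnegative, so
    counting it repeatedly only enlarges the sum.\<close>
  also have "\<dots> \<le> (\<Sum>t\<in>T. trace (word (f t)))"
    using sum_image_le[OF finT, of "\<lambda>cs. trace (word cs)" f] trace_word_nonneg by (simp add: o_def)
  also have "\<dots> = (\<Sum>ip\<in>I. \<Sum>us\<in>words (fst ip). \<Sum>c\<in>K. \<Sum>vs\<in>words (snd ip).
      \<Sum>ws\<in>words (2 * n - fst ip - snd ip). trace (word (us @ [c] @ vs @ [c] @ ws)))"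
  proof -
    have "(\<Sum>ip\<in>I. \<Sum>us\<in>words (fst ip). \<Sum>c\<in>K. \<Sum>vs\<in>words (snd ip).
        \<Sum>ws\<in>words (2 * n - fst ip - snd ip). trace (word (us @ [c] @ vs @ [c] @ ws)))
      = (\<Sum>ip\<in>I. \<Sum>t\<in>words (fst ip) \<times> K \<times> words (snd ip) \<times> words (2 * n - fst ip - snd ip).
          trace (word (f (ip, t))))"
      by (simp add: sum.cartesian_product f_def case_prod_unfold)
    also have "\<dots> = (\<Sum>t\<in>T. trace (word (f t)))"
      unfolding T_def using finI finite_K finite_words
      by (subst sum.Sigma) (auto simp: case_prod_unfold)
    finally show ?thesis by simp
  qed
  also have "\<dots> = (\<Sum>ip\<in>I. conflict (snd ip) (2 * n - fst ip - snd ip + fst ip))"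
    by (simp add: sum_repeated del: append_Cons append_Nil)
  also have "\<dots> \<le> (\<Sum>ip\<in>I. D * w n)"
    by (intro sum_mono conflict_le) (auto simp: I_def)
  also have "\<dots> = card I * (D * w n)" by simp
  also have "\<dots> \<le> (2 * n + 2)\<^sup>2 * (D * w n)"
  proof (intro mult_right_mono)
    show "real (card I) \<le> real ((2 * n + 2)\<^sup>2)" using cardI by (simp only: of_nat_le_iff)
    \<comment> \<open>The locale does not assume \<open>D\<close> to be nonnegative; nonnegativity
      of the bound follows because \<open>conflict (2 * n) 0\<close> is a sum of squared
      norms.\<close>
    have "conflict (2 * n) 0 \<ge> 0"
      unfolding conflict_def using ip_split[of 0 _ n 0 n]
      by (intro sum_nonneg) (simp add: mult_2 ip_def, metis (no_types, lifting) ip_def sum_nonneg zero_le_square)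
    then show "0 \<le> D * w n" using conflict_end[of n] by simp
  qed
  finally show ?thesis by (simp add: add.commute)
qed

text \<open>The factor is (2 n + 2)^2 \<open>D\<close>, the loss in \<open>sum_non_distinct\<close>.
  If the last ratio of \<open>w\<close> did not exceed it, \<open>w_le_geometric\<close> would
  contradict the assumption. So closed walks of length 2 n + 2 outnumber those with a repeated
  colour, and a remaining one is cut down to a cycle.\<close>

lemma rainbow_cycle_of_w:
  assumes "w (Suc n) > (4 * (Suc n)\<^sup>2 * D) ^ Suc n * card S" "D \<ge> 0"
  shows "\<exists>x ps. walk adj x ps x \<and> ps \<noteq> [] \<and> distinct (map fst ps) \<and> distinct (map snd ps)
    \<and> set (map fst ps) \<subseteq> K \<and> length ps \<le> 2 * Suc n"
proof -
  have "\<not> w (Suc n) \<le> 4 * (Suc n)\<^sup>2 * D * w n"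
    using w_le_geometric[of n "4 * (Suc n)\<^sup>2 * D" "Suc n"] assms w_0 by auto
  then have gt: "w (Suc n) > (2 * real n + 2)\<^sup>2 * (D * w n)"
    by (simp add: power2_eq_square algebra_simps)
  have "w (Suc n) = (\<Sum>cs\<in>words (2 * n + 2). trace (word cs))"
    by (simp add: w_trace msum_words flip: trace_msum del: pw.simps)
  also have "\<dots> = (\<Sum>cs | cs \<in> words (2 * n + 2) \<and> distinct cs. trace (word cs))
      + (\<Sum>cs | cs \<in> words (2 * n + 2) \<and> \<not> distinct cs. trace (word cs))"
    using finite_words[of "2 * n + 2"]
    by (subst sum.union_disjoint[symmetric]) (auto intro!: sum.cong)
  finally have "(\<Sum>cs | cs \<in> words (2 * n + 2) \<and> distinct cs. trace (word cs)) \<noteq> 0"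
    using gt sum_non_distinct[of n] by linarith
  then obtain cs where cs: "cs \<in> words (2 * n + 2)" "distinct cs" "trace (word cs) \<noteq> 0"
    by (metis (mono_tags, lifting) mem_Collect_eq sum.not_neutral_contains_not_neutral)
  then obtain x where "word cs x x \<noteq> 0"
    unfolding trace_def by (meson sum.not_neutral_contains_not_neutral)
  then obtain ps where ps: "map fst ps = cs" "walk adj x ps x" using walk_of_word by blast
  have "ps \<noteq> []" using ps cs by (auto simp: words_def)
  then obtain x' ps' where "walk adj x' ps' x'" "ps' \<noteq> []" "distinct (map fst ps')"
      "distinct (map snd ps')" "set (map fst ps') \<subseteq> set (map fst ps)" "length ps' \<le> length ps"
    using shortest_rainbow_cycle[of adj x ps] ps cs by metis
  moreover have "set (map fst ps) \<subseteq> K" "length ps = 2 * Suc n"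
    using ps cs by (auto simp: words_def simp flip: length_map[of fst])
  ultimately show ?thesis by (metis order_trans)
qed

section \<open>From minimum degrees to a rainbow cycle\<close>

text \<open>Counts only walks alternating between \<open>Q1\<close> and \<open>Q2\<close>: every two
  steps multiply their number by at least
  \<open>\<delta>\<^sub>1 * \<delta>\<^sub>2\<close>.\<close>

lemma row_sum_ge:
  assumes Q: "Q1 \<subseteq> S" "Q2 \<subseteq> S" and nn: "\<delta>\<^sub>1 \<ge> 0" "\<delta>\<^sub>2 \<ge> 0"
    and d1: "\<And>x. x \<in> Q1 \<Longrightarrow> \<delta>\<^sub>1 \<le> (\<Sum>y\<in>Q2. Adj x y)"
    and d2: "\<And>y. y \<in> Q2 \<Longrightarrow> \<delta>\<^sub>2 \<le> (\<Sum>x\<in>Q1. Adj y x)"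
    and "x \<in> Q1"
  shows "(\<delta>\<^sub>1 * \<delta>\<^sub>2) ^ l \<le> (\<Sum>y\<in>S. pw (2 * l) x y)"
  using \<open>x \<in> Q1\<close>
proof (induction l arbitrary: x)
  case 0
  then show ?case using Q finite_S by (auto simp: one_def if_distrib cong: if_cong)
next
  case (Suc l)
  \<comment> \<open>The number of walks of length n from x.\<close>
  define R where "R n x = (\<Sum>y\<in>S. pw n x y)" for n x
  have nonneg: "Adj x y \<ge> 0" for x y unfolding Adj_def by (intro sum_nonneg) (simp add: M_def)
  have pwnn: "pw n x y \<ge> 0" for n x y
    by (induction n arbitrary: x y) (auto simp: one_def mul_def intro!: sum_nonneg mult_nonneg_nonneg nonneg)
  have Rnn: "R n x \<ge> 0" for n x unfolding R_def by (intro sum_nonneg pwnn)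
  have R_Suc: "R (Suc n) x = (\<Sum>z\<in>S. Adj x z * R n z)" for n x
    unfolding R_def pw.simps mul_def by (subst sum.swap) (simp add: sum_distrib_left)
  have step: "\<delta> * b \<le> R (Suc n) x"
    if "P \<subseteq> S" "\<delta> \<le> (\<Sum>z\<in>P. Adj x z)" "\<And>z. z \<in> P \<Longrightarrow> b \<le> R n z" "b \<ge> 0" for P \<delta> b n x
  proof -
    have "\<delta> * b \<le> (\<Sum>z\<in>P. Adj x z) * b" using that by (intro mult_right_mono)
    also have "\<dots> \<le> (\<Sum>z\<in>P. Adj x z * R n z)"
      unfolding sum_distrib_right using that nonneg by (intro sum_mono mult_left_mono) auto
    also have "\<dots> \<le> R (Suc n) x" unfolding R_Suc
      using that finite_S nonneg Rnn by (intro sum_mono2) auto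
    finally show ?thesis .
  qed
  have Q2_ge: "\<delta>\<^sub>2 * (\<delta>\<^sub>1 * \<delta>\<^sub>2) ^ l \<le> R (Suc (2 * l)) y" if "y \<in> Q2" for y
    using that d2 Suc.IH Q nn by (intro step[of Q1]) (auto simp: R_def)
  have "\<delta>\<^sub>1 * (\<delta>\<^sub>2 * (\<delta>\<^sub>1 * \<delta>\<^sub>2) ^ l) \<le> R (Suc (Suc (2 * l))) x"
    by (rule step[of Q2]) (use Suc.prems d1 Q nn Q2_ge in auto)
  then show ?case by (simp add: R_def mult_ac)
qed

text \<open>A single row sum of \<open>pw L\<close> forces many closed walks by Cauchy-Schwarz, at
  the price of a factor \<open>card S\<close>; the second such factor in \<open>big\<close> is the
  value \<open>w 0\<close> in the criterion. For even L the alternating walks return to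
  \<open>Q1\<close>, so the bound is symmetric in the two degrees.\<close>

lemma ex_rainbow_cycle:
  assumes Q: "Q1 \<subseteq> S" "Q2 \<subseteq> S" "Q1 \<noteq> {}" and nn: "\<delta>\<^sub>1 \<ge> 0" "\<delta>\<^sub>2 \<ge> 0" "D \<ge> 0"
    and d1: "\<And>x. x \<in> Q1 \<Longrightarrow> \<delta>\<^sub>1 \<le> (\<Sum>y\<in>Q2. Adj x y)"
    and d2: "\<And>y. y \<in> Q2 \<Longrightarrow> \<delta>\<^sub>2 \<le> (\<Sum>x\<in>Q1. Adj y x)"
    and L: "even L" "L > 0"
    and big: "(4 * (real L)\<^sup>2 * D) ^ L * (card S)\<^sup>2 < (\<delta>\<^sub>1 * \<delta>\<^sub>2) ^ L"
  shows "\<exists>x ps. walk adj x ps x \<and> ps \<noteq> [] \<and> distinct (map fst ps) \<and> distinct (map snd ps)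
    \<and> set (map fst ps) \<subseteq> K \<and> length ps \<le> 2 * L"
proof -
  obtain l where l: "L = 2 * l" using L by blast
  obtain n where n: "L = Suc n" using L by (cases L) auto
  obtain x where x: "x \<in> Q1" using Q by blast
  then have "x \<in> S" using Q by blast
  then have S_pos: "card S > 0" using finite_S by (auto simp: card_gt_0_iff)
  have "(\<delta>\<^sub>1 * \<delta>\<^sub>2) ^ L = ((\<delta>\<^sub>1 * \<delta>\<^sub>2) ^ l)\<^sup>2" by (simp add: l power_mult[symmetric] mult.commute)
  also have "\<dots> \<le> (\<Sum>y\<in>S. pw L x y)\<^sup>2"
    unfolding l using row_sum_ge[OF Q(1,2) nn(1,2) d1 d2 x] nn by (intro power_mono) auto
  also have "\<dots> = (\<Sum>y\<in>S. 1 * pw L x y)\<^sup>2" by simp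
  also have "\<dots> \<le> (\<Sum>y\<in>S. 1\<^sup>2) * (\<Sum>y\<in>S. (pw L x y)\<^sup>2)" by (rule Cauchy_Schwarz_ineq_sum)
  also have "\<dots> \<le> card S * w L"
  proof -
    have "(\<Sum>y\<in>S. (pw L x y)\<^sup>2) \<le> (\<Sum>x\<in>S. \<Sum>y\<in>S. (pw L x y)\<^sup>2)"
      using \<open>x \<in> S\<close> finite_S by (intro member_le_sum) (auto intro: sum_nonneg)
    then show ?thesis by (simp add: w_def ip_def power2_eq_square mult_left_mono)
  qed
  finally have "(4 * (real L)\<^sup>2 * D) ^ L * (card S)\<^sup>2 < card S * w L" using big by simp
  then have "(4 * (real L)\<^sup>2 * D) ^ L * card S < w L"
    using S_pos by (simp add: power2_eq_square mult.assoc mult.left_commute)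
  then show ?thesis using rainbow_cycle_of_w[of n] nn n by simp
qed

end

section \<open>Tripartite hypergraphs\<close>

text \<open>Take the blocks in exactly one of \<open>F\<close> and \<open>G\<close>. A vertex
  outside \<open>A\<close> lies in only one block and has degree 2 there. A vertex of
  \<open>A\<close> covered by one family is covered by the other too, by a different block, so the
  degrees add to 1 + 1. With \<open>A\<close> = \<open>UNIV\<close> and single edges as blocks this
  is the matching argument.\<close>

lemma has_regular_sub_of_two_families:
  assumes deg: "\<And>Z v. Z \<in> \<Z> \<Longrightarrow> v \<in> \<Union>Z \<Longrightarrow> vdegree Z v = (if v \<in> A then 1 else 2)"
    and disj: "\<And>Z Z'. Z \<in> \<Z> \<Longrightarrow> Z' \<in> \<Z> \<Longrightarrow> Z \<noteq> Z' \<Longrightarrow> Z \<inter> Z' = {} \<and> \<Union>Z \<inter> \<Union>Z' \<subseteq> A"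
    and fin: "\<And>Z. Z \<in> \<Z> \<Longrightarrow> Z \<noteq> {} \<and> finite Z \<and> Z \<subseteq> E"
    and sub: "F \<subseteq> \<Z>" "G \<subseteq> \<Z>" "F \<noteq> G"
    and F: "\<And>Z Z'. Z \<in> F \<Longrightarrow> Z' \<in> F \<Longrightarrow> Z \<noteq> Z' \<Longrightarrow> \<Union>Z \<inter> \<Union>Z' = {}"
    and G: "\<And>Z Z'. Z \<in> G \<Longrightarrow> Z' \<in> G \<Longrightarrow> Z \<noteq> Z' \<Longrightarrow> \<Union>Z \<inter> \<Union>Z' = {}"
    and cover: "A \<inter> \<Union>(\<Union>F) = A \<inter> \<Union>(\<Union>G)"
  shows "has_regular_sub 2 E"
proof -
  \<comment> \<open>Stated for arbitrary \<open>F\<close> and \<open>G\<close> so that it can be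
    applied again with their roles exchanged.\<close>
  have main: "vdegree (\<Union>((F - G) \<union> (G - F))) v = 2"
    if FG: "F \<subseteq> \<Z>" "G \<subseteq> \<Z>"
      and F: "\<And>Z Z'. Z \<in> F \<Longrightarrow> Z' \<in> F \<Longrightarrow> Z \<noteq> Z' \<Longrightarrow> \<Union>Z \<inter> \<Union>Z' = {}"
      and G: "\<And>Z Z'. Z \<in> G \<Longrightarrow> Z' \<in> G \<Longrightarrow> Z \<noteq> Z' \<Longrightarrow> \<Union>Z \<inter> \<Union>Z' = {}"
      and cover: "A \<inter> \<Union>(\<Union>F) = A \<inter> \<Union>(\<Union>G)"
      and Z: "Z \<in> F - G" "v \<in> \<Union>Z"
    for F G Z v
  proof (cases "v \<in> A")
    case False
    have "Z' = Z" if "Z' \<in> (F - G) \<union> (G - F)" "v \<in> \<Union>Z'" for Z'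
      using disj[of Z Z'] that Z FG False by blast
    then have eq: "{e \<in> \<Union>((F - G) \<union> (G - F)). v \<in> e} = {e \<in> Z. v \<in> e}" using Z by blast
    have "vdegree Z v = 2" using deg[of Z v] Z FG False by (metis DiffD1 subsetD)
    then show ?thesis unfolding vdegree_def eq .
  next
    case True
    then have "v \<in> A \<inter> \<Union>(\<Union>G)" using Z cover by blast
    then obtain Y where Y: "Y \<in> G" "v \<in> \<Union>Y" by blast
    \<comment> \<open>Distinct members of \<open>F\<close> are disjoint, but Y and Z share v, so Y
      survives in the symmetric difference.\<close>
    have "Y \<notin> F" using F[of Z Y] Y Z by blast
    have "Z' = Z \<or> Z' = Y" if "Z' \<in> (F - G) \<union> (G - F)" "v \<in> \<Union>Z'" for Z'
      using F[of Z Z'] G[of Y Z'] that Z Y by blast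
    then have eq: "{e \<in> \<Union>((F - G) \<union> (G - F)). v \<in> e} = {e \<in> Z. v \<in> e} \<union> {e \<in> Y. v \<in> e}"
      using Z Y \<open>Y \<notin> F\<close> by blast
    have "Z \<in> \<Z>" "Y \<in> \<Z>" "Z \<noteq> Y" using Z Y FG by auto
    then have "card ({e \<in> Z. v \<in> e} \<union> {e \<in> Y. v \<in> e}) = card {e \<in> Z. v \<in> e} + card {e \<in> Y. v \<in> e}"
      using disj[of Z Y] fin by (intro card_Un_disjoint) auto
    moreover have "card {e \<in> Z. v \<in> e} = 1" "card {e \<in> Y. v \<in> e} = 1"
      using deg[of Z v] deg[of Y v] \<open>Z \<in> \<Z>\<close> \<open>Y \<in> \<Z>\<close> Z Y True by (auto simp: vdegree_def)
    ultimately show ?thesis unfolding vdegree_def eq by simp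
  qed
  define E' where "E' = \<Union>((F - G) \<union> (G - F))"
  have "E' \<noteq> {}" using sub fin unfolding E'_def by blast
  moreover have "E' \<subseteq> E" using sub fin unfolding E'_def by blast
  moreover have "vdegree E' v = 2" if v: "v \<in> \<Union>E'" for v
  proof -
    obtain Z where "Z \<in> (F - G) \<union> (G - F)" "v \<in> \<Union>Z" using v unfolding E'_def by blast
    then show ?thesis
      using main[OF sub(1,2) F G cover, of Z v] main[OF sub(2,1) G F cover[symmetric], of Z v]
      unfolding E'_def by (auto simp: Un_commute)
  qed
  ultimately show ?thesis unfolding has_regular_sub_def regular_def by blast
qed

definition independent :: "('z \<Rightarrow> 'z \<Rightarrow> bool) \<Rightarrow> 'z set \<Rightarrow> nat \<Rightarrow> 'z set set" where
  "independent confl \<Z> r =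
     {F. F \<subseteq> \<Z> \<and> card F = r \<and> (\<forall>z\<in>F. \<forall>z'\<in>F. z \<noteq> z' \<longrightarrow> \<not> confl z z')}"

text \<open>Choose the elements one after another. Those chosen block at most r q elements, at most
  half of all, so there are at least (|Z| / 2)^r ordered choices; division by r! forgets the
  order.\<close>

lemma many_independent_sets:
  assumes fin: "finite \<Z>" and deg: "\<And>z. z \<in> \<Z> \<Longrightarrow> card {z' \<in> \<Z>. confl z z'} \<le> q"
    and refl: "\<And>z. z \<in> \<Z> \<Longrightarrow> confl z z" and sym: "\<And>z z'. confl z z' \<Longrightarrow> confl z' z"
    and small: "2 * r * q \<le> card \<Z>"
  shows "card \<Z> ^ r \<le> card (independent confl \<Z> r) * fact r * 2 ^ r"
  using small
proof (induction r)
  case 0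
  have "independent confl \<Z> 0 = {{}}"
    using fin by (auto simp: independent_def dest: finite_subset)
  then show ?case by simp
next
  case (Suc r)
  define s where "s = card \<Z>"
  let ?I = "independent confl \<Z>"
  define T where "T = (SIGMA F:?I r. {z \<in> \<Z>. \<forall>f\<in>F. \<not> confl f z})"
  have finI: "finite (?I r)" for r
    by (rule finite_subset[of _ "Pow \<Z>"]) (auto simp: independent_def fin)
  have finF: "finite F" if "F \<in> ?I r" for F r
    using that fin by (auto simp: independent_def intro: finite_subset)
  have lower: "s \<le> 2 * card {z \<in> \<Z>. \<forall>f\<in>F. \<not> confl f z}" if F: "F \<in> ?I r" for F
  proof -
    have "card (\<Union>f\<in>F. {z \<in> \<Z>. confl f z}) \<le> (\<Sum>f\<in>F. card {z \<in> \<Z>. confl f z})"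
      using finF[OF F] by (rule card_UN_le)
    also have "\<dots> \<le> (\<Sum>f\<in>F. q)" using F by (intro sum_mono deg) (auto simp: independent_def)
    also have "\<dots> = r * q" using F by (simp add: independent_def)
    finally have "card (\<Union>f\<in>F. {z \<in> \<Z>. confl f z}) \<le> r * q" .
    moreover have "{z \<in> \<Z>. \<forall>f\<in>F. \<not> confl f z} = \<Z> - (\<Union>f\<in>F. {z \<in> \<Z>. confl f z})" by auto
    moreover have "s - card (\<Union>f\<in>F. {z \<in> \<Z>. confl f z}) \<le> card (\<Z> - (\<Union>f\<in>F. {z \<in> \<Z>. confl f z}))"
      unfolding s_def using fin finF[OF F] by (intro diff_card_le_card_Diff) auto
    moreover have "2 * (r * q) \<le> s" using Suc.prems unfolding s_def by simp
    ultimately show ?thesis by simp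
  qed
  have "card (?I r) * s = (\<Sum>F\<in>?I r. s)" by simp
  also have "\<dots> \<le> (\<Sum>F\<in>?I r. 2 * card {z \<in> \<Z>. \<forall>f\<in>F. \<not> confl f z})"
    by (intro sum_mono lower)
  also have "\<dots> = 2 * card T"
    unfolding T_def using finI fin by (subst card_SigmaI) (auto simp: sum_distrib_left)
  \<comment> \<open>An independent set with an extension by z becomes a larger independent set with
    the marked element z; reflexivity of \<open>confl\<close> makes z new, so the map is
    injective.\<close>
  also have "card T \<le> card (SIGMA G:?I (Suc r). G)"
  proof (rule card_inj_on_le)
    have notin: "z \<notin> F" if "(F, z) \<in> T" for F z
      using that refl by (auto simp: T_def independent_def)
    show "inj_on (\<lambda>(F, z). (insert z F, z)) T"
      using notin by (auto simp: inj_on_def) (metis insert_ident)+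
    show "(\<lambda>(F, z). (insert z F, z)) ` T \<subseteq> (SIGMA G:?I (Suc r). G)"
    proof clarify
      fix F z assume Fz: "(F, z) \<in> T"
      then have "F \<in> ?I r" by (simp add: T_def)
      then show "insert z F \<in> ?I (Suc r) \<and> z \<in> insert z F"
        using Fz notin[OF Fz] finF[of F r] sym by (auto simp: T_def independent_def)
    qed
    show "finite (SIGMA G:?I (Suc r). G)" using finI finF by (intro finite_SigmaI) auto
  qed
  also have "card (SIGMA G:?I (Suc r). G) = (\<Sum>G\<in>?I (Suc r). card G)"
    using finI finF by (intro card_SigmaI) auto
  also have "\<dots> = (\<Sum>G\<in>?I (Suc r). Suc r)" by (intro sum.cong) (auto simp: independent_def)
  finally have step: "card (?I r) * s \<le> 2 * (card (?I (Suc r)) * Suc r)" by simp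
  have "s ^ r \<le> card (?I r) * fact r * 2 ^ r" unfolding s_def using Suc by simp
  then have "s ^ Suc r \<le> s * (card (?I r) * fact r * 2 ^ r)" by simp
  also have "\<dots> = (card (?I r) * s) * (fact r * 2 ^ r)" by (simp add: mult_ac)
  also have "\<dots> \<le> (2 * (card (?I (Suc r)) * Suc r)) * (fact r * 2 ^ r)"
    by (intro mult_right_mono step) simp
  also have "\<dots> = card (?I (Suc r)) * fact (Suc r) * 2 ^ Suc r" by (simp add: algebra_simps)
  finally show ?case by (simp add: s_def)
qed

text \<open>Take a smallest edge set whose size still exceeds the total weight of its covered
  vertices in V. Deleting a vertex of degree at most its weight would lose no more edges than weight
  and give a smaller such set.\<close>

lemma min_degree_sub:
  fixes t :: "'a \<Rightarrow> real"
  assumes "finite E" "finite V" "\<And>v. t v \<ge> 0" "(\<Sum>v\<in>V. t v) < card E"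
  shows "\<exists>E'\<subseteq>E. E' \<noteq> {} \<and> (\<forall>v\<in>V \<inter> \<Union>E'. t v < vdegree E' v)"
proof -
  define P where "P E' \<longleftrightarrow> E' \<subseteq> E \<and> (\<Sum>v\<in>V \<inter> \<Union>E'. t v) < card E'" for E'
  have "(\<Sum>v\<in>V \<inter> \<Union>E. t v) \<le> (\<Sum>v\<in>V. t v)" using assms by (intro sum_mono2) auto
  then have "P E" using assms by (simp add: P_def)
  then obtain E' where E': "P E'" and min: "\<And>E''. P E'' \<Longrightarrow> card E' \<le> card E''"
    using arg_min_natI[of P E card] arg_min_nat_le[of P _ card] by metis
  have fin: "finite E'" using E' assms by (auto simp: P_def intro: finite_subset)
  have "E' \<noteq> {}"
    using E' assms(3) by (auto simp: P_def)
  moreover have "t v < vdegree E' v" if v: "v \<in> V \<inter> \<Union>E'" for v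
  proof (rule ccontr)
    assume not: "\<not> t v < vdegree E' v"
    define E'' where "E'' = E' - {e \<in> E'. v \<in> e}"
    have card: "card E' = card E'' + vdegree E' v"
      unfolding E''_def vdegree_def using fin
      by (metis (lifting) add.commute card_Diff_subset card_mono finite_subset le_add_diff_inverse
          mem_Collect_eq subsetI)
    have "(\<Sum>v\<in>V \<inter> \<Union>E''. t v) \<le> (\<Sum>v\<in>V \<inter> \<Union>E' - {v}. t v)"
      using assms by (intro sum_mono2) (auto simp: E''_def)
    also have "\<dots> = (\<Sum>v\<in>V \<inter> \<Union>E'. t v) - t v" using v assms by (subst sum_diff1) auto
    also have "\<dots> < card E''" using E' not card by (auto simp: P_def)
    finally have "P E''" using E' by (auto simp: P_def E''_def)
    then have "vdegree E' v = 0" using min[of E''] card by simp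
    then show False using v fin by (auto simp: vdegree_def)
  qed
  ultimately show ?thesis using E' unfolding P_def by blast
qed

section \<open>Tripartite hypergraphs and their rainbow cycles\<close>

definition tripartite :: "'a set \<Rightarrow> 'a set \<Rightarrow> 'a set \<Rightarrow> 'a set set \<Rightarrow> bool" where
  "tripartite A B C E \<longleftrightarrow> finite A \<and> finite B \<and> finite C \<and> A \<inter> B = {} \<and> A \<inter> C = {} \<and> B \<inter> C = {}
     \<and> (\<forall>e\<in>E. \<exists>a\<in>A. \<exists>b\<in>B. \<exists>c\<in>C. e = {a, b, c})"

lemma tripartite_edge:
  assumes "tripartite A B C E" "e \<in> E"
  obtains a b c where "a \<in> A" "b \<in> B" "c \<in> C" "e = {a, b, c}"
  using assms unfolding tripartite_def by (elim conjE ballE bexE) auto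

lemma tripartite_mono: "tripartite A B C E \<Longrightarrow> E' \<subseteq> E \<Longrightarrow> tripartite A B C E'"
  unfolding tripartite_def by (meson subsetD)

lemma linear_edges_mono: "linear_edges E \<Longrightarrow> E' \<subseteq> E \<Longrightarrow> linear_edges E'"
  unfolding linear_edges_def by blast

lemma tripartite_finite: assumes "tripartite A B C E" shows "finite E" "\<And>e. e \<in> E \<Longrightarrow> finite e"
proof -
  have "E \<subseteq> Pow (A \<union> B \<union> C)" using assms by (auto simp: tripartite_def)
  moreover have fin: "finite (A \<union> B \<union> C)" using assms by (auto simp: tripartite_def)
  ultimately show "finite E" "\<And>e. e \<in> E \<Longrightarrow> finite e"
    by (auto intro: finite_subset dest: finite_subset[OF _ fin])
qed

lemma tripartite_third:
  assumes "tripartite A B C E" "{c, x, y} \<in> E" "c \<in> A" "x \<in> B \<union> C" "y \<in> B \<union> C"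
  shows "x \<in> B \<and> y \<in> C \<or> x \<in> C \<and> y \<in> B"
proof -
  obtain a' b' c' where abc: "a' \<in> A" "b' \<in> B" "c' \<in> C" "{c, x, y} = {a', b', c'}"
    using tripartite_edge[OF assms(1,2)] .
  have disj: "A \<inter> B = {}" "A \<inter> C = {}" "B \<inter> C = {}" using assms by (auto simp: tripartite_def)
  have "b' \<in> {c, x, y}" "c' \<in> {c, x, y}" using abc(4) by auto
  then show ?thesis using abc disj assms(3-5) by blast
qed

lemma linear_edges_two_points:
  assumes "linear_edges E" "e \<in> E" "e' \<in> E" "x \<in> e" "y \<in> e" "x \<in> e'" "y \<in> e'" "x \<noteq> y" "finite e"
  shows "e = e'"
proof (rule ccontr)
  assume "e \<noteq> e'"
  then have "card (e \<inter> e') \<le> 1" using assms by (auto simp: linear_edges_def)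
  moreover have "card {x, y} \<le> card (e \<inter> e')" using assms by (intro card_mono) auto
  ultimately show False using assms(8) by simp
qed

lemma walk_nth:
  assumes "walk adj x ps y" "i < length ps"
  shows "adj (fst (ps ! i)) (if i = 0 then x else snd (ps ! (i - 1))) (snd (ps ! i))"
  using assms
proof (induction ps arbitrary: x i)
  case (Cons p ps)
  obtain c z where p: "p = (c, z)" by (cases p)
  show ?case
  proof (cases i)
    case 0
    then show ?thesis using Cons.prems p by simp
  next
    case (Suc j)
    then have "adj (fst (ps ! j)) (if j = 0 then z else snd (ps ! (j - 1))) (snd (ps ! j))"
      using Cons.prems p by (intro Cons.IH) auto
    then show ?thesis using Suc p by (cases j) auto
  qed
qed simp

lemma walk_last: "walk adj x ps y \<Longrightarrow> ps \<noteq> [] \<Longrightarrow> snd (last ps) = y"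
proof (induction ps arbitrary: x)
  case (Cons p ps)
  then show ?case by (cases p; cases ps) auto
qed simp

text \<open>The colours of the cycle are vertices of the hypergraph as well, namely those in \<open>A\<close>. They have
  degree one and form the boundary that has to be cancelled against other cycles.\<close>

definition rainbow_cycle :: "'a set \<Rightarrow> nat \<Rightarrow> 'a set set \<Rightarrow> bool" where
  "rainbow_cycle A l Z \<longleftrightarrow> Z \<noteq> {} \<and> finite Z \<and> card (\<Union>Z \<inter> A) \<le> l \<and> card (\<Union>Z - A) \<le> l
     \<and> (\<forall>v\<in>\<Union>Z. vdegree Z v = (if v \<in> A then 1 else 2))"

text \<open>The edges of \<open>Z\<close> are the steps of the cycle with their colours. Each vertex
  of the walk ends one step and begins the next, while each colour occurs once.\<close>

lemma rainbow_cycle_of_walk: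
  assumes walk: "walk adj x ps x" and ne: "ps \<noteq> []"
    and col: "distinct (map fst ps)" and ver: "distinct (map snd ps)"
    and adj: "\<And>c y z. adj c y z \<Longrightarrow> {c, y, z} \<in> E \<and> c \<in> A \<and> y \<notin> A \<and> z \<notin> A \<and> y \<noteq> z"
  shows "\<exists>Z\<subseteq>E. rainbow_cycle A (length ps) Z"
proof -
  define m where "m = length ps"
  define c where "c i = fst (ps ! i)" for i
  define v where "v i = snd (ps ! i)" for i
  \<comment> \<open>The cyclic predecessor: the walk starts at its last recorded vertex.\<close>
  define p where "p i = (if i = 0 then m - 1 else i - 1)" for i
  define e where "e i = {c i, v (p i), v i}" for i
  have m: "m > 0" using ne by (simp add: m_def)
  have p_less: "p i < m" if "i < m" for i using that by (auto simp: p_def)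
  have x: "x = v (m - 1)" using walk_last[OF walk ne] ne by (simp add: v_def m_def last_conv_nth)
  have step: "adj (c i) (v (p i)) (v i)" if "i < m" for i
    using walk_nth[OF walk, of i] that x by (auto simp: c_def v_def p_def m_def split: if_splits)
  note step' = adj[OF step]
  have c_inj: "c i = c j \<longleftrightarrow> i = j" if "i < m" "j < m" for i j
    using col that nth_eq_iff_index_eq[OF col, of i j] by (simp add: c_def m_def)
  have v_inj: "v i = v j \<longleftrightarrow> i = j" if "i < m" "j < m" for i j
    using ver that nth_eq_iff_index_eq[OF ver, of i j] by (simp add: v_def m_def)
  have c_in: "c i \<in> A" and v_notin: "v i \<notin> A" if "i < m" for i using step'[OF that] by auto
  have cv: "c i \<noteq> v j" if "i < m" "j < m" for i j using c_in v_notin that by metis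
  \<comment> \<open>A walk of length one would be a loop, excluded because the two ends of a step
    differ.\<close>
  have m2: "m \<ge> 2"
  proof (rule ccontr)
    assume "\<not> m \<ge> 2"
    then have "m = 1" using m by simp
    then show False using step'[of 0] by (simp add: p_def)
  qed
  define Z where "Z = e ` {..<m}"
  have e_inj: "inj_on e {..<m}"
  proof (rule inj_onI)
    fix i j assume ij: "i \<in> {..<m}" "j \<in> {..<m}" "e i = e j"
    then have "c i \<in> e j" by (auto simp: e_def)
    then show "i = j" using ij cv c_inj p_less by (auto simp: e_def)
  qed
  have deg: "vdegree Z u = card {i. i < m \<and> u \<in> e i}" for u
  proof -
    have "{f \<in> Z. u \<in> f} = e ` {i. i < m \<and> u \<in> e i}" by (auto simp: Z_def)
    moreover have "inj_on e {i. i < m \<and> u \<in> e i}" using e_inj by (auto simp: inj_on_def)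
    ultimately show ?thesis by (simp add: vdegree_def card_image)
  qed
  have deg_c: "vdegree Z (c j) = 1" if j: "j < m" for j
  proof -
    have "{i. i < m \<and> c j \<in> e i} = {j}" using j cv c_inj p_less by (auto simp: e_def)
    then show ?thesis by (simp add: deg)
  qed
  have deg_v: "vdegree Z (v j) = 2" if j: "j < m" for j
  proof -
    \<comment> \<open>The cyclic successor of j; the step n is the other one containing
      \<open>v j\<close>.\<close>
    define n where "n = (if j = m - 1 then 0 else j + 1)"
    have "n < m" "n \<noteq> j" using j m2 by (auto simp: n_def)
    have p_eq: "p i = j \<longleftrightarrow> i = n" if "i < m" for i
      using that j m2 by (auto simp: p_def n_def split: if_splits)
    have "{i. i < m \<and> v j \<in> e i} = {i. i < m \<and> (p i = j \<or> i = j)}"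
      using j cv[symmetric] v_inj p_less by (auto simp: e_def)
    also have "\<dots> = {n, j}" using p_eq j \<open>n < m\<close> by auto
    finally show ?thesis using \<open>n \<noteq> j\<close> by (simp add: deg)
  qed
  have union: "u \<in> \<Union>Z \<Longrightarrow> u \<in> c ` {..<m} \<or> u \<in> v ` {..<m}" for u
    using p_less by (auto simp: Z_def e_def)
  have "card (\<Union>Z \<inter> A) \<le> card (c ` {..<m})"
    using union v_notin by (intro card_mono) auto
  also have "\<dots> \<le> m" using card_image_le[of "{..<m}" c] by simp
  finally have 1: "card (\<Union>Z \<inter> A) \<le> m" .
  have "card (\<Union>Z - A) \<le> card (v ` {..<m})"
    using union c_in by (intro card_mono) auto
  also have "\<dots> \<le> m" using card_image_le[of "{..<m}" v] by simp
  finally have 2: "card (\<Union>Z - A) \<le> m" .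
  have 3: "vdegree Z u = (if u \<in> A then 1 else 2)" if "u \<in> \<Union>Z" for u
    using union[OF that] deg_c deg_v c_in v_notin by auto
  have "Z \<subseteq> E" using step' by (auto simp: Z_def e_def)
  moreover have "Z \<noteq> {}" using m by (auto simp: Z_def)
  ultimately show ?thesis using 1 2 3 unfolding rainbow_cycle_def m_def[symmetric]
    by (intro exI[of _ Z]) (auto simp: Z_def)
qed

lemma tripartite_swap: "tripartite A B C E \<Longrightarrow> tripartite A C B E"
  unfolding tripartite_def by (metis inf_commute insert_commute)

lemma tripartite_rotate: "tripartite A B C E \<Longrightarrow> tripartite B C A E"
  unfolding tripartite_def by (metis inf_commute insert_commute)

lemma tripartite_degree:
  assumes tri: "tripartite A B C E" and lin: "linear_edges E" and x: "x \<in> B"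
  shows "(\<Sum>c\<in>A. \<Sum>y\<in>C \<inter> \<Union>E. of_bool ({c, x, y} \<in> E)) = real (vdegree E x)"
proof -
  let ?P = "{(c, y). c \<in> A \<and> y \<in> C \<inter> \<Union>E \<and> {c, x, y} \<in> E}"
  have fin: "finite A" "finite C" using tri by (auto simp: tripartite_def)
  have disj: "A \<inter> B = {}" "A \<inter> C = {}" "B \<inter> C = {}" using tri by (auto simp: tripartite_def)
  have "(\<Sum>c\<in>A. \<Sum>y\<in>C \<inter> \<Union>E. of_bool ({c, x, y} \<in> E))
      = (\<Sum>(c, y)\<in>A \<times> (C \<inter> \<Union>E). of_bool ({c, x, y} \<in> E) :: real)"
    by (simp add: sum.cartesian_product)
  also have "\<dots> = (\<Sum>cy\<in>?P. 1)"
    using fin by (intro sum.mono_neutral_cong_right) auto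
  also have "\<dots> = card ?P" by simp
  also have "card ?P = card {e \<in> E. x \<in> e}"
  proof (rule bij_betw_same_card)
    show "bij_betw (\<lambda>(c, y). {c, x, y}) ?P {e \<in> E. x \<in> e}"
      unfolding bij_betw_def
    proof
      show "inj_on (\<lambda>(c, y). {c, x, y}) ?P"
      proof (rule inj_onI, clarify)
        fix c y c' y' assume *: "c \<in> A" "y \<in> C" "c' \<in> A" "y' \<in> C" "{c, x, y} = {c', x, y'}"
        have "c \<in> {c', x, y'}" "y \<in> {c', x, y'}" using *(5) by blast+
        then show "c = c' \<and> y = y'" using * x disj by blast
      qed
      show "(\<lambda>(c, y). {c, x, y}) ` ?P = {e \<in> E. x \<in> e}"
      proof
        show "{e \<in> E. x \<in> e} \<subseteq> (\<lambda>(c, y). {c, x, y}) ` ?P"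
        proof
          fix e assume e: "e \<in> {e \<in> E. x \<in> e}"
          then obtain a b c where abc: "a \<in> A" "b \<in> B" "c \<in> C" "e = {a, b, c}"
            using tri unfolding tripartite_def by (metis (lifting) mem_Collect_eq)
          then have "b = x" using e x disj by blast
          then have "(a, c) \<in> ?P" "e = (\<lambda>(c, y). {c, x, y}) (a, c)" using abc e by auto
          then show "e \<in> (\<lambda>(c, y). {c, x, y}) ` ?P" by (rule rev_image_eqI)
        qed
      qed auto
    qed
  qed
  finally show ?thesis by (simp add: vdegree_def)
qed

text \<open>The colours are the vertices of \<open>A\<close>, and the coloured graph lives on
  \<open>B \<union> C\<close>. Minimum degrees hold only at covered vertices, so the alternating
  walks are counted inside \<open>B \<inter> \<Union>E\<close> and
  \<open>C \<inter> \<Union>E\<close>.\<close>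

lemma hypergraph_rainbow_cycle:
  assumes tri: "tripartite A B C E" and lin: "linear_edges E" and ne: "E \<noteq> {}"
    and D: "\<And>v. v \<in> B \<union> C \<Longrightarrow> real (vdegree E v) \<le> D"
    and d1: "\<And>v. v \<in> B \<inter> \<Union>E \<Longrightarrow> \<delta>\<^sub>1 \<le> real (vdegree E v)"
    and d2: "\<And>v. v \<in> C \<inter> \<Union>E \<Longrightarrow> \<delta>\<^sub>2 \<le> real (vdegree E v)"
    and nn: "\<delta>\<^sub>1 \<ge> 0" "\<delta>\<^sub>2 \<ge> 0" "D \<ge> 0"
    and L: "even L" "L > 0"
    and big: "(4 * (real L)\<^sup>2 * D) ^ L * (card (B \<union> C))\<^sup>2 < (\<delta>\<^sub>1 * \<delta>\<^sub>2) ^ L"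
  shows "\<exists>Z\<subseteq>E. rainbow_cycle A (2 * L) Z"
proof -
  define adj where "adj c x y \<longleftrightarrow> {c, x, y} \<in> E \<and> c \<in> A \<and> x \<in> B \<union> C \<and> y \<in> B \<union> C" for c x y
  have disj: "A \<inter> B = {}" "A \<inter> C = {}" "B \<inter> C = {}" using tri by (auto simp: tripartite_def)
  have fin: "finite A" "finite B" "finite C" using tri by (auto simp: tripartite_def)
  have in_Union: "y \<in> \<Union>E" if "{c, x, y} \<in> E" for c x y using that by blast
  have adj_iff: "adj c x y \<longleftrightarrow> {c, x, y} \<in> E \<and> y \<in> C \<inter> \<Union>E" if "x \<in> B" "c \<in> A" for c x y
    using tripartite_third[OF tri, of c x y] that disj in_Union[of c x y] by (auto simp: adj_def)
  have adj_iff': "adj c x y \<longleftrightarrow> {c, x, y} \<in> E \<and> y \<in> B \<inter> \<Union>E" if "x \<in> C" "c \<in> A" for c x y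
    using tripartite_third[OF tri, of c x y] that disj in_Union[of c x y] by (auto simp: adj_def)
  have row: "(\<Sum>c\<in>A. \<Sum>y\<in>Q. of_bool (adj c x y)) = real (vdegree E x)"
    if "x \<in> B" "C \<inter> \<Union>E \<subseteq> Q" "finite Q" for x Q
  proof -
    have "(\<Sum>y\<in>Q. of_bool (adj c x y) :: real) = (\<Sum>y\<in>C \<inter> \<Union>E. of_bool ({c, x, y} \<in> E))"
      if "c \<in> A" for c
      using that \<open>x \<in> B\<close> \<open>C \<inter> \<Union>E \<subseteq> Q\<close> \<open>finite Q\<close> adj_iff[of x c]
      by (intro sum.mono_neutral_cong_right) auto
    then show ?thesis using tripartite_degree[OF tri lin \<open>x \<in> B\<close>] by simp
  qed
  have row': "(\<Sum>c\<in>A. \<Sum>y\<in>Q. of_bool (adj c x y)) = real (vdegree E x)"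
    if "x \<in> C" "B \<inter> \<Union>E \<subseteq> Q" "finite Q" for x Q
  proof -
    have "(\<Sum>y\<in>Q. of_bool (adj c x y) :: real) = (\<Sum>y\<in>B \<inter> \<Union>E. of_bool ({c, x, y} \<in> E))"
      if "c \<in> A" for c
      using that \<open>x \<in> C\<close> \<open>B \<inter> \<Union>E \<subseteq> Q\<close> \<open>finite Q\<close> adj_iff'[of x c]
      by (intro sum.mono_neutral_cong_right) auto
    then show ?thesis using tripartite_degree[OF tripartite_swap[OF tri] lin \<open>x \<in> C\<close>] by simp
  qed
  \<comment> \<open>Linearity makes the colouring proper: two edges through c and x
    coincide.\<close>
  have proper: "y = z" if "adj c x y" "adj c x z" for c x y z
  proof -
    have "c \<noteq> x" using that disj by (auto simp: adj_def)
    then have "{c, x, y} = {c, x, z}"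
      using linear_edges_two_points[OF lin, of "{c, x, y}" "{c, x, z}" c x] that
      by (auto simp: adj_def)
    then have "y \<in> {c, x, z}" by blast
    moreover have "y \<noteq> c" "y \<noteq> x"
      using tripartite_third[OF tri, of c x y] that disj by (auto simp: adj_def)
    ultimately show ?thesis by simp
  qed
  interpret coloured_graph "B \<union> C" A adj D
  proof
    fix x assume "x \<in> B \<union> C"
    moreover have "C \<inter> \<Union>E \<subseteq> B \<union> C" "B \<inter> \<Union>E \<subseteq> B \<union> C" "finite (B \<union> C)" using fin by auto
    ultimately show "(\<Sum>c\<in>A. \<Sum>y\<in>B \<union> C. of_bool (adj c x y)) \<le> D"
      using row[of x "B \<union> C"] row'[of x "B \<union> C"] D[of x] by auto
  next
    show "adj c y x" if "adj c x y" for c x y using that by (auto simp: adj_def insert_commute)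
  qed (use fin proper in \<open>auto simp: adj_def\<close>)
  have Adj_sum: "(\<Sum>y\<in>Q. Adj x y) = (\<Sum>c\<in>A. \<Sum>y\<in>Q. of_bool (adj c x y))" for x Q
    unfolding Adj_def M_def by (rule sum.swap)
  obtain e where "e \<in> E" using ne by blast
  then obtain a b c where "a \<in> A" "b \<in> B" "c \<in> C" "e = {a, b, c}"
    using tri unfolding tripartite_def by metis
  then have B_ne: "B \<inter> \<Union>E \<noteq> {}" using \<open>e \<in> E\<close> by blast
  have "\<exists>x ps. walk adj x ps x \<and> ps \<noteq> [] \<and> distinct (map fst ps) \<and> distinct (map snd ps)
      \<and> set (map fst ps) \<subseteq> A \<and> length ps \<le> 2 * L"
  proof (rule ex_rainbow_cycle[OF _ _ B_ne nn _ _ L big])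
    show "\<delta>\<^sub>1 \<le> (\<Sum>y\<in>C \<inter> \<Union>E. Adj x y)" if "x \<in> B \<inter> \<Union>E" for x
      using row[of x "C \<inter> \<Union>E"] d1[of x] that fin by (simp add: Adj_sum)
    show "\<delta>\<^sub>2 \<le> (\<Sum>y\<in>B \<inter> \<Union>E. Adj x y)" if "x \<in> C \<inter> \<Union>E" for x
      using row'[of x "B \<inter> \<Union>E"] d2[of x] that fin by (simp add: Adj_sum)
  qed auto
  then obtain x ps where ps: "walk adj x ps x" "ps \<noteq> []" "distinct (map fst ps)"
    "distinct (map snd ps)" "length ps \<le> 2 * L" by blast
  have "\<exists>Z\<subseteq>E. rainbow_cycle A (length ps) Z"
  proof (rule rainbow_cycle_of_walk[OF ps(1-4)])
    show "{c, y, z} \<in> E \<and> c \<in> A \<and> y \<notin> A \<and> z \<notin> A \<and> y \<noteq> z" if "adj c y z" for c y z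
      using tripartite_third[OF tri, of c y z] that disj by (auto simp: adj_def)
  qed
  then show ?thesis using ps(5) unfolding rainbow_cycle_def by (meson order_trans)
qed

section \<open>Pigeonhole for matchings and for families of rainbow cycles\<close>

lemma card_filter_eq_sum: "finite A \<Longrightarrow> card {x \<in> A. P x} = (\<Sum>x\<in>A. of_bool (P x))"
  by (simp add: Int_def)

text \<open>The quotient of r^r by r! is one term of the series of exp(r), and e is at most
  3.\<close>

lemma power_self_le_fact: "real r ^ r \<le> 3 ^ r * fact r"
proof -
  have "(\<Sum>n\<in>{r}. inverse (fact n) * real r ^ n) \<le> (\<Sum>n. inverse (fact n) * real r ^ n)"
    using summable_exp[of "real r"] by (intro sum_le_suminf) (auto simp: divide_inverse)
  also have "\<dots> = exp (real r)" by (simp add: exp_def scaleR_conv_of_real)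
  also have "\<dots> = exp 1 ^ r" by (metis exp_of_nat_mult mult.right_neutral)
  also have "\<dots> \<le> 3 ^ r" using exp_le by (intro power_mono) auto
  finally show ?thesis by (simp add: field_simps)
qed

lemma card_subsets_le:
  assumes "finite A"
  shows "card {X. X \<subseteq> A \<and> card X \<le> m} \<le> (card A + m) choose m"
proof -
  have "{X. X \<subseteq> A \<and> card X \<le> m} = (\<Union>k\<le>m. {X. X \<subseteq> A \<and> card X = k})" by auto
  then have "card {X. X \<subseteq> A \<and> card X \<le> m} \<le> (\<Sum>k\<le>m. card {X. X \<subseteq> A \<and> card X = k})"
    by (simp add: card_UN_le)
  also have "\<dots> = (\<Sum>k\<le>m. (card A choose k) * 1)" by (simp add: n_subsets[OF assms])
  \<comment> \<open>Inserting factors at least 1 completes the sum to Vandermonde's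
    identity.\<close>
  also have "\<dots> \<le> (\<Sum>k\<le>m. (card A choose k) * (m choose (m - k)))"
    by (intro sum_mono mult_left_mono) (auto simp: Suc_le_eq)
  also have "\<dots> = (card A + m) choose m" by (rule vandermonde)
  finally show ?thesis .
qed

lemma tripartite_card_edge:
  assumes "tripartite A B C E" "e \<in> E"
  shows "card (A \<inter> e) = 1" "card e = 3" "e \<subseteq> A \<union> B \<union> C"
proof -
  obtain a b c where "a \<in> A" "b \<in> B" "c \<in> C" "e = {a, b, c}"
    using tripartite_edge[OF assms] .
  moreover have "A \<inter> B = {}" "A \<inter> C = {}" "B \<inter> C = {}" using assms by (auto simp: tripartite_def)
  ultimately show "card (A \<inter> e) = 1" "card e = 3" "e \<subseteq> A \<union> B \<union> C"
    by (auto simp: Int_insert_right disjoint_iff card_insert_if)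
qed

lemma card_edges_meeting:
  assumes "finite U" "\<And>v. v \<in> U \<Longrightarrow> vdegree E v \<le> d"
  shows "card {e \<in> E. e \<inter> U \<noteq> {}} \<le> card U * d"
proof -
  have "{e \<in> E. e \<inter> U \<noteq> {}} = (\<Union>v\<in>U. {e \<in> E. v \<in> e})" by auto
  then have "card {e \<in> E. e \<inter> U \<noteq> {}} \<le> (\<Sum>v\<in>U. vdegree E v)"
    using assms by (simp add: vdegree_def card_UN_le)
  also have "\<dots> \<le> card U * d" using sum_mono[of U "vdegree E" "\<lambda>_. d", OF assms(2)] by simp
  finally show ?thesis .
qed

lemma card_matching_cover:
  assumes tri: "tripartite A B C E" and M: "M \<subseteq> E"
    and disj: "\<And>e f. e \<in> M \<Longrightarrow> f \<in> M \<Longrightarrow> e \<noteq> f \<Longrightarrow> e \<inter> f = {}"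
  shows "card (A \<inter> \<Union>M) = card M"
proof -
  have fin: "finite M" using tripartite_finite(1)[OF tri] M by (rule finite_subset[rotated])
  have "A \<inter> \<Union>M = (\<Union>e\<in>M. A \<inter> e)" by auto
  also have "card \<dots> = (\<Sum>e\<in>M. card (A \<inter> e))"
  proof (rule card_UN_disjoint[OF fin])
    show "\<forall>e\<in>M. finite (A \<inter> e)" using tri by (auto simp: tripartite_def)
    show "\<forall>e\<in>M. \<forall>f\<in>M. e \<noteq> f \<longrightarrow> A \<inter> e \<inter> (A \<inter> f) = {}" using disj by blast
  qed
  also have "\<dots> = card M" using tripartite_card_edge(1)[OF tri] M by (simp add: subset_eq)
  finally show ?thesis .
qed

text \<open>By linearity an edge is determined by its vertices in \<open>A\<close> and
  \<open>B\<close>.\<close>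

lemma linear_card_le:
  assumes tri: "tripartite A B C E" and lin: "linear_edges E"
  shows "card E \<le> card A * card B"
proof -
  have ex: "\<exists>p. p \<in> A \<times> B \<and> fst p \<in> e \<and> snd p \<in> e" if "e \<in> E" for e
  proof -
    obtain a b c where "a \<in> A" "b \<in> B" "e = {a, b, c}"
      using tripartite_edge[OF tri \<open>e \<in> E\<close>] .
    then show ?thesis by (intro exI[of _ "(a, b)"]) auto
  qed
  then obtain g where g: "\<And>e. e \<in> E \<Longrightarrow> g e \<in> A \<times> B \<and> fst (g e) \<in> e \<and> snd (g e) \<in> e" by metis
  have disj: "A \<inter> B = {}" using tri by (auto simp: tripartite_def)
  have "card E \<le> card (A \<times> B)"
  proof (rule card_inj_on_le)
    show "inj_on g E"
    proof (rule inj_onI)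
      fix e f assume *: "e \<in> E" "f \<in> E" "g e = g f"
      have "fst (g e) \<noteq> snd (g e)" using g[OF *(1)] disj by (metis IntI empty_iff mem_Times_iff)
      then show "e = f"
        using linear_edges_two_points[OF lin *(1,2), of "fst (g e)" "snd (g e)"] g[OF *(1)] g[OF *(2)]
          *(3) tripartite_finite(2)[OF tri *(1)] by simp
    qed
    show "g ` E \<subseteq> A \<times> B" using g by blast
    show "finite (A \<times> B)" using tri by (auto simp: tripartite_def)
  qed
  then show ?thesis by (simp add: card_cartesian_product)
qed

text \<open>Pigeonhole: at least (|E| / 2)^r / r! matchings of size r against at most (|A| |B|
  |C|)^r / (r!)^3 triples of covered r-sets. Bounding r! from below by (r / 3)^r yields 18 = 2 *
  3^2. An edge meets at most 3 d edges, whence 6 r d.\<close>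

lemma regular_sub_of_matchings:
  assumes tri: "tripartite A B C E"
    and r: "r \<ge> 1" "6 * r * d \<le> card E"
    and deg: "\<And>v. v \<in> A \<union> B \<union> C \<Longrightarrow> vdegree E v \<le> d"
    and many: "18 * real (card A) * real (card B) * real (card C) < real (card E) * (real r)\<^sup>2"
  shows "has_regular_sub 2 E"
proof -
  define confl where "confl = (\<lambda>e f :: 'a set. e \<inter> f \<noteq> {})"
  define I where "I = independent confl E r"
  define \<Phi> where "\<Phi> M = (A \<inter> \<Union>M, B \<inter> \<Union>M, C \<inter> \<Union>M)" for M
  define e where "e = card E"
  note fin = tripartite_finite[OF tri]
  have finV: "finite A" "finite B" "finite C" using tri by (auto simp: tripartite_def)
  have count: "e ^ r \<le> card I * fact r * 2 ^ r"
    unfolding I_def e_def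
  proof (rule many_independent_sets[OF fin(1), of _ "3 * d"])
    fix f assume f: "f \<in> E"
    have "card {g \<in> E. g \<inter> f \<noteq> {}} \<le> card f * d"
      using tripartite_card_edge[OF tri f] fin(2)[OF f] by (intro card_edges_meeting deg) auto
    then show "card {g \<in> E. confl f g} \<le> 3 * d"
      using tripartite_card_edge(2)[OF tri f] by (simp add: confl_def Int_commute)
    show "confl f f" using tripartite_card_edge(2)[OF tri f] by (auto simp: confl_def)
  qed (use r in \<open>auto simp: confl_def\<close>)
  have I: "M \<subseteq> E \<and> card M = r \<and> (\<forall>f\<in>M. \<forall>g\<in>M. f \<noteq> g \<longrightarrow> f \<inter> g = {})" if "M \<in> I" for M
    using that by (auto simp: I_def independent_def confl_def)
  have "\<not> inj_on \<Phi> I"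
  proof
    assume inj: "inj_on \<Phi> I"
    define R where "R X = {Y. Y \<subseteq> X \<and> card Y = r}" for X :: "'a set"
    have cardR: "card (R X) = card X choose r" if "finite X" for X
      unfolding R_def by (rule n_subsets[OF that])
    have "card I \<le> card (R A \<times> R B \<times> R C)"
    proof (rule card_inj_on_le[OF inj])
      show "\<Phi> ` I \<subseteq> R A \<times> R B \<times> R C"
        using I card_matching_cover[OF tri] card_matching_cover[OF tripartite_rotate[OF tri]]
          card_matching_cover[OF tripartite_rotate[OF tripartite_rotate[OF tri]]]
        by (auto simp: \<Phi>_def R_def)
      show "finite (R A \<times> R B \<times> R C)" unfolding R_def using finV by auto
    qed
    also have "\<dots> = (card A choose r) * (card B choose r) * (card C choose r)"
      by (simp add: card_cartesian_product cardR finV)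
    finally have cI: "card I \<le> (card A choose r) * (card B choose r) * (card C choose r)" .
    have "e ^ r * (fact r)\<^sup>2 \<le> (card I * fact r * 2 ^ r) * (fact r)\<^sup>2"
      by (intro mult_right_mono count) simp
    also have "\<dots> \<le> ((card A choose r) * (card B choose r) * (card C choose r) * fact r * 2 ^ r) * (fact r)\<^sup>2"
      by (intro mult_right_mono cI) auto
    also have "\<dots> = ((card A choose r) * fact r) * (((card B choose r) * fact r) * ((card C choose r) * fact r)) * 2 ^ r"
      by (simp add: power2_eq_square mult_ac)
    also have "\<dots> \<le> (card A ^ r * (card B ^ r * card C ^ r)) * 2 ^ r"
      using binomial_fact_pow by (intro mult_mono) auto
    finally have "real (e ^ r * (fact r)\<^sup>2) \<le> real ((card A ^ r * (card B ^ r * card C ^ r)) * 2 ^ r)"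
      by (simp only: of_nat_le_iff)
    then have upper: "real e ^ r * (fact r)\<^sup>2 \<le> (2 * (real (card A) * real (card B) * real (card C))) ^ r"
      by (simp add: power_mult_distrib mult_ac)
    have "(real r / 3) ^ r \<le> fact r" using power_self_le_fact[of r] by (simp add: power_divide field_simps)
    then have "real e ^ r * ((real r / 3) ^ r)\<^sup>2 \<le> real e ^ r * (fact r)\<^sup>2"
      by (intro mult_left_mono power_mono) auto
    also note upper
    also have "real e ^ r * ((real r / 3) ^ r)\<^sup>2 = (real e * (real r / 3)\<^sup>2) ^ r"
      by (simp only: power_mult_distrib power_mult[symmetric] mult.commute[of 2 r])
    finally have "real e * (real r / 3)\<^sup>2 \<le> 2 * (real (card A) * real (card B) * real (card C))"
      using r by (subst (asm) power_mono_iff) auto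
    then show False using many by (simp add: e_def power_divide)
  qed
  then obtain M N where MN: "M \<in> I" "N \<in> I" "\<Phi> M = \<Phi> N" "M \<noteq> N" by (auto simp: inj_on_def)
  have cover: "\<Union>M = \<Union>N"
  proof -
    have "\<Union>M' = (A \<inter> \<Union>M') \<union> (B \<inter> \<Union>M') \<union> (C \<inter> \<Union>M')" if M': "M' \<in> I" for M'
    proof -
      have "f \<subseteq> A \<union> B \<union> C" if "f \<in> M'" for f
        using I[OF M'] tripartite_card_edge(3)[OF tri, of f] that by (meson subsetD)
      then have "\<Union>M' \<subseteq> A \<union> B \<union> C" by (rule Union_least)
      then show ?thesis by blast
    qed
    then show ?thesis using MN unfolding \<Phi>_def by (metis prod.inject)
  qed
  show ?thesis
  proof (rule has_regular_sub_of_two_families[where \<Z> = "(\<lambda>f. {f}) ` E" and A = UNIV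
        and F = "(\<lambda>f. {f}) ` M" and G = "(\<lambda>f. {f}) ` N"])
    show "(\<lambda>f. {f}) ` M \<noteq> (\<lambda>f. {f}) ` N" using MN(4) by (auto simp: inj_image_eq_iff)
    show "vdegree Z v = (if v \<in> UNIV then 1 else 2)" if Zv: "Z \<in> (\<lambda>f. {f}) ` E" "v \<in> \<Union>Z" for Z v
    proof -
      obtain f where "Z = {f}" "v \<in> f" using Zv by auto
      then have "{g \<in> Z. v \<in> g} = {f}" by auto
      then show ?thesis by (simp add: vdegree_def)
    qed
    show "\<Union>Z \<inter> \<Union>Z' = {}" if "Z \<in> (\<lambda>f. {f}) ` M" "Z' \<in> (\<lambda>f. {f}) ` M" "Z \<noteq> Z'" for Z Z'
      using I[OF MN(1)] that by (elim imageE) simp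
    show "\<Union>Z \<inter> \<Union>Z' = {}" if "Z \<in> (\<lambda>f. {f}) ` N" "Z' \<in> (\<lambda>f. {f}) ` N" "Z \<noteq> Z'" for Z Z'
      using I[OF MN(2)] that by (elim imageE) simp
  qed (use I[OF MN(1)] I[OF MN(2)] cover in auto)
qed

section \<open>Packing rainbow cycles and counting their colour sets\<close>

text \<open>Discard edges at used vertices of \<open>B \<union> C\<close> and at colours already
  used \<tau> times. Saturated colours number at most 2 L j / \<tau>, and each loses at most
  \<open>DA\<close>, hence at most \<tau> \<open>DB\<close>, edges; so they cost no more than the
  used vertices and half of the edges remain.\<close>

lemma greedy_rainbow_cycles:
  fixes \<Lambda> :: real
  assumes tri: "tripartite A B C E" and lin: "linear_edges E" and ne: "E \<noteq> {}"
    and dA: "\<And>v. v \<in> A \<Longrightarrow> vdegree E v \<le> DA"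
    and dB: "\<And>v. v \<in> B \<Longrightarrow> vdegree E v \<le> DB"
    and dC: "\<And>v. v \<in> C \<Longrightarrow> vdegree E v \<le> DC"
    and sB: "real (card B) * DB \<le> \<Lambda> * card E" and sC: "real (card C) * DC \<le> \<Lambda> * card E"
    and ord: "DC \<le> DB" and tau: "DA \<le> \<tau> * DB" and pos: "DB > 0" "\<Lambda> > 0"
    and L: "even L" "L > 0"
    and big: "(real (card (B \<union> C)))\<^sup>2 < (DC / (256 * \<Lambda>\<^sup>2 * (real L)\<^sup>2)) ^ L"
    and s: "8 * L * s * DB \<le> card E"
  shows "\<exists>\<Z>. card \<Z> = s \<and> finite \<Z> \<and> (\<forall>Z\<in>\<Z>. Z \<subseteq> E \<and> rainbow_cycle A (2 * L) Z)
     \<and> (\<forall>Z\<in>\<Z>. \<forall>Z'\<in>\<Z>. Z \<noteq> Z' \<longrightarrow> Z \<inter> Z' = {} \<and> \<Union>Z \<inter> \<Union>Z' \<subseteq> A)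
     \<and> (\<forall>a\<in>A. card {Z \<in> \<Z>. a \<in> \<Union>Z} \<le> \<tau>)"
  using s
proof (induction s)
  case 0
  show ?case by (intro exI[of _ "{}"]) auto
next
  case (Suc j)
  have "8 * L * j * DB \<le> 8 * L * Suc j * DB" by simp
  then have "8 * L * j * DB \<le> card E" using Suc.prems by (rule order_trans)
  from Suc.IH[OF this] obtain \<Z> where IH: "card \<Z> = j" "finite \<Z>"
      "\<forall>Z\<in>\<Z>. Z \<subseteq> E \<and> rainbow_cycle A (2 * L) Z"
      "\<forall>Z\<in>\<Z>. \<forall>Z'\<in>\<Z>. Z \<noteq> Z' \<longrightarrow> Z \<inter> Z' = {} \<and> \<Union>Z \<inter> \<Union>Z' \<subseteq> A"
      "\<forall>a\<in>A. card {Z \<in> \<Z>. a \<in> \<Union>Z} \<le> \<tau>"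
    by (elim exE conjE) (rule that)
  have \<Z>: "card \<Z> = j" "finite \<Z>"
      "\<And>Z. Z \<in> \<Z> \<Longrightarrow> Z \<subseteq> E" "\<And>Z. Z \<in> \<Z> \<Longrightarrow> rainbow_cycle A (2 * L) Z"
      "\<And>Z Z'. Z \<in> \<Z> \<Longrightarrow> Z' \<in> \<Z> \<Longrightarrow> Z \<noteq> Z' \<Longrightarrow> Z \<inter> Z' = {} \<and> \<Union>Z \<inter> \<Union>Z' \<subseteq> A"
      "\<And>a. a \<in> A \<Longrightarrow> card {Z \<in> \<Z>. a \<in> \<Union>Z} \<le> \<tau>"
    using IH(1,2) bspec[OF IH(3)] bspec[OF bspec[OF IH(4)]] bspec[OF IH(5)] by (simp_all del: Union_iff)
  have finV: "finite A" "finite B" "finite C" using tri by (auto simp: tripartite_def)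
  have disj: "A \<inter> B = {}" "A \<inter> C = {}" "B \<inter> C = {}" using tri by (auto simp: tripartite_def)
  note finE = tripartite_finite[OF tri]
  define U where "U = (\<Union>Z\<in>\<Z>. \<Union>Z - A)"
  define W where "W = {a \<in> A. \<tau> \<le> card {Z \<in> \<Z>. a \<in> \<Union>Z}}"
  have sub: "\<Union>Z \<subseteq> A \<union> B \<union> C" if "Z \<subseteq> E" for Z
    using tripartite_card_edge(3)[OF tri] that by blast
  have U_sub: "U \<subseteq> B \<union> C" using sub \<Z>(3) unfolding U_def by blast
  then have finU: "finite U" using finV by (auto intro: finite_subset)
  have "card U \<le> (\<Sum>Z\<in>\<Z>. card (\<Union>Z - A))" unfolding U_def by (rule card_UN_le[OF \<Z>(2)])
  also have "\<dots> \<le> (\<Sum>Z\<in>\<Z>. 2 * L)" using \<Z>(4) by (intro sum_mono) (auto simp: rainbow_cycle_def)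
  finally have cardU: "card U \<le> 2 * L * j" using \<Z>(1) by (simp add: mult_ac)
  have cardW: "card W * \<tau> \<le> 2 * L * j"
  proof -
    have "card W * \<tau> = (\<Sum>a\<in>W. \<tau>)" by simp
    also have "\<dots> \<le> (\<Sum>a\<in>W. card {Z \<in> \<Z>. a \<in> \<Union>Z})" by (intro sum_mono) (auto simp: W_def)
    also have "\<dots> \<le> (\<Sum>a\<in>A. card {Z \<in> \<Z>. a \<in> \<Union>Z})"
      using finV by (intro sum_mono2) (auto simp: W_def)
    also have "\<dots> = (\<Sum>a\<in>A. \<Sum>Z\<in>\<Z>. of_bool (a \<in> \<Union>Z))"
      by (intro sum.cong refl card_filter_eq_sum \<Z>(2))
    also have "\<dots> = (\<Sum>Z\<in>\<Z>. \<Sum>a\<in>A. of_bool (a \<in> \<Union>Z))" by (rule sum.swap)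
    also have "\<dots> = (\<Sum>Z\<in>\<Z>. card (\<Union>Z \<inter> A))"
    proof (intro sum.cong refl)
      fix Z assume "Z \<in> \<Z>"
      have "\<Union>Z \<inter> A = {a \<in> A. a \<in> \<Union>Z}" by blast
      then show "(\<Sum>a\<in>A. of_bool (a \<in> \<Union>Z)) = card (\<Union>Z \<inter> A)"
        using card_filter_eq_sum[OF finV(1), of "\<lambda>a. a \<in> \<Union>Z"] by presburger
    qed
    also have "\<dots> \<le> (\<Sum>Z\<in>\<Z>. 2 * L)" using \<Z>(4) by (intro sum_mono) (auto simp: rainbow_cycle_def)
    finally show ?thesis using \<Z>(1) by (simp add: mult_ac)
  qed
  define E' where "E' = {e \<in> E. e \<inter> (U \<union> W) = {}}"
  have E': "E' \<subseteq> E" by (auto simp: E'_def)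
  have "E = E' \<union> {e \<in> E. e \<inter> U \<noteq> {}} \<union> {e \<in> E. e \<inter> W \<noteq> {}}" by (auto simp: E'_def)
  then have "card E \<le> card E' + card {e \<in> E. e \<inter> U \<noteq> {}} + card {e \<in> E. e \<inter> W \<noteq> {}}"
    by (metis (no_types, lifting) add_le_mono1 card_Un_le order_trans)
  moreover have "card {e \<in> E. e \<inter> U \<noteq> {}} \<le> card U * DB"
    using finU U_sub dB dC ord by (intro card_edges_meeting) (auto intro: order_trans)
  moreover have "card U * DB \<le> 2 * L * j * DB" using cardU by simp
  moreover have "card {e \<in> E. e \<inter> W \<noteq> {}} \<le> card W * DA"
    using finV dA by (intro card_edges_meeting) (auto simp: W_def)
  moreover have "card W * DA \<le> card W * (\<tau> * DB)" using tau by simp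
  moreover have "card W * (\<tau> * DB) \<le> 2 * L * j * DB"
    using mult_right_mono[OF cardW, of DB] by (simp add: mult_ac)
  ultimately have "card E \<le> card E' + 4 * L * j * DB" by (simp only: mult.assoc)
  moreover have "2 * (4 * L * j * DB) \<le> card E" using \<open>8 * L * j * DB \<le> card E\<close> by (simp add: mult_ac)
  ultimately have cardE': "card E \<le> 2 * card E'" by linarith
  \<comment> \<open>The total weight is at most 2 \<Lambda> |E| / (8 \<Lambda>), a quarter of |E|,
    while at least half of the edges remain.\<close>
  define t where "t v = (if v \<in> B then DB / (8 * \<Lambda>) else DC / (8 * \<Lambda>))" for v
  have cardE: "card E > 0" using ne finE by (simp add: card_gt_0_iff)
  have "(\<Sum>v\<in>B \<union> C. t v) = (\<Sum>v\<in>B. t v) + (\<Sum>v\<in>C. t v)"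
    using finV disj by (intro sum.union_disjoint) auto
  also have "(\<Sum>v\<in>C. t v) = (\<Sum>v\<in>C. DC / (8 * \<Lambda>))"
    using disj by (intro sum.cong) (auto simp: t_def)
  also have "(\<Sum>v\<in>B. t v) + (\<Sum>v\<in>C. DC / (8 * \<Lambda>)) = (real (card B) * DB + real (card C) * DC) / (8 * \<Lambda>)"
    by (simp add: t_def add_divide_distrib)
  also have "\<dots> \<le> (\<Lambda> * card E + \<Lambda> * card E) / (8 * \<Lambda>)"
    using sB sC pos by (intro divide_right_mono add_mono) auto
  also have "\<dots> = card E / 4" using pos by (simp add: field_simps)
  also have "\<dots> < card E'" using cardE' cardE by linarith
  finally have "(\<Sum>v\<in>B \<union> C. t v) < card E'" .
  then obtain E'' where E'': "E'' \<subseteq> E'" "E'' \<noteq> {}" "\<forall>v\<in>(B \<union> C) \<inter> \<Union>E''. t v < vdegree E'' v"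
  proof -
    have "finite E'" "finite (B \<union> C)" using finE E' finV by (auto intro: finite_subset)
    moreover have "t v \<ge> 0" for v using pos by (simp add: t_def)
    ultimately show ?thesis
      using min_degree_sub[of E' "B \<union> C" t] \<open>(\<Sum>v\<in>B \<union> C. t v) < card E'\<close> that by blast
  qed
  have E''E: "E'' \<subseteq> E" using E'' E' by blast
  have deg_mono: "vdegree E'' v \<le> vdegree E v" for v
    unfolding vdegree_def using finE E''E by (intro card_mono) auto
  have "\<exists>Z\<subseteq>E''. rainbow_cycle A (2 * L) Z"
  proof (rule hypergraph_rainbow_cycle[OF tripartite_mono[OF tri E''E] linear_edges_mono[OF lin E''E] E''(2)])
    show "real (vdegree E'' v) \<le> real DB" if "v \<in> B \<union> C" for v
      using deg_mono[of v] dB[of v] dC[of v] ord that by auto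
    show "DB / (8 * \<Lambda>) \<le> real (vdegree E'' v)" if "v \<in> B \<inter> \<Union>E''" for v
    proof -
      have "t v < vdegree E'' v" using E''(3) that by blast
      then show ?thesis using that by (simp add: t_def)
    qed
    show "DC / (8 * \<Lambda>) \<le> real (vdegree E'' v)" if "v \<in> C \<inter> \<Union>E''" for v
    proof -
      have "t v < vdegree E'' v" using E''(3) that by blast
      moreover have "v \<notin> B" using that disj by auto
      ultimately show ?thesis by (simp add: t_def)
    qed
    have "(4 * (real L)\<^sup>2 * DB) ^ L * (card (B \<union> C))\<^sup>2
        < (4 * (real L)\<^sup>2 * DB) ^ L * (DC / (256 * \<Lambda>\<^sup>2 * (real L)\<^sup>2)) ^ L"
      using big pos L by (intro mult_strict_left_mono) auto
    also have "\<dots> = (4 * (real L)\<^sup>2 * DB * (DC / (256 * \<Lambda>\<^sup>2 * (real L)\<^sup>2))) ^ L"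
      by (simp only: power_mult_distrib)
    \<comment> \<open>256 = 4 * 8 * 8: the 4 comes from the cycle criterion, each 8 from one minimum
      degree. \<open>DB\<close> cancels, so only \<open>DC\<close> has to be large.\<close>
    also have "4 * (real L)\<^sup>2 * DB * (DC / (256 * \<Lambda>\<^sup>2 * (real L)\<^sup>2)) = DB / (8 * \<Lambda>) * (DC / (8 * \<Lambda>))"
      using L pos by (simp add: power2_eq_square)
    finally show "(4 * (real L)\<^sup>2 * DB) ^ L * (card (B \<union> C))\<^sup>2 < (DB / (8 * \<Lambda>) * (DC / (8 * \<Lambda>))) ^ L" .
  qed (use L pos in auto)
  then obtain Z where Z: "Z \<subseteq> E''" "rainbow_cycle A (2 * L) Z" by blast
  have Z_E': "Z \<subseteq> E'" using Z E'' by blast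
  have Z_U: "\<Union>Z \<inter> U = {}" and Z_W: "\<Union>Z \<inter> W = {}" using Z_E' by (auto simp: E'_def)
  have new: "Z \<inter> Z' = {} \<and> \<Union>Z \<inter> \<Union>Z' \<subseteq> A" if "Z' \<in> \<Z>" for Z'
  proof
    show *: "\<Union>Z \<inter> \<Union>Z' \<subseteq> A" using Z_U that unfolding U_def by blast
    show "Z \<inter> Z' = {}"
    proof (rule ccontr)
      assume "Z \<inter> Z' \<noteq> {}"
      then obtain f where f: "f \<in> Z" "f \<in> Z'" by blast
      then have "f \<in> E" using \<Z>(3) that by blast
      then obtain a b c where "b \<in> B" "f = {a, b, c}" using tripartite_edge[OF tri] by metis
      then show False using * f disj by blast
    qed
  qed
  have "Z \<noteq> {}" using Z by (simp add: rainbow_cycle_def)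
  then have "Z \<notin> \<Z>" using new[of Z] by blast
  show ?case
  proof (intro exI[of _ "insert Z \<Z>"] conjI ballI impI)
    show "card (insert Z \<Z>) = Suc j" using \<Z> \<open>Z \<notin> \<Z>\<close> by simp
    show "Y \<subseteq> E" "rainbow_cycle A (2 * L) Y" if "Y \<in> insert Z \<Z>" for Y
      using that \<Z>(3,4) Z E''E by auto
    show "Y \<inter> Y' = {}" "\<Union>Y \<inter> \<Union>Y' \<subseteq> A"
      if YY': "Y \<in> insert Z \<Z>" "Y' \<in> insert Z \<Z>" "Y \<noteq> Y'" for Y Y'
    proof -
      consider "Y = Z" "Y' \<in> \<Z>" | "Y' = Z" "Y \<in> \<Z>" | "Y \<in> \<Z>" "Y' \<in> \<Z>" using YY' by blast
      then have "Y \<inter> Y' = {} \<and> \<Union>Y \<inter> \<Union>Y' \<subseteq> A"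
      proof cases
        case 1
        then show ?thesis using new by simp
      next
        case 2
        then show ?thesis using new[of Y] by (metis Int_commute)
      next
        case 3
        then show ?thesis using \<Z>(5) YY'(3) by simp
      qed
      then show "Y \<inter> Y' = {}" "\<Union>Y \<inter> \<Union>Y' \<subseteq> A" by blast+
    qed
    show "card {Y \<in> insert Z \<Z>. a \<in> \<Union>Y} \<le> \<tau>" if a: "a \<in> A" for a
    proof (cases "a \<in> \<Union>Z")
      case True
      then have "a \<notin> W" using Z_W by blast
      then have "card {Y \<in> \<Z>. a \<in> \<Union>Y} < \<tau>" using a by (auto simp: W_def)
      moreover have "{Y \<in> insert Z \<Z>. a \<in> \<Union>Y} = insert Z {Y \<in> \<Z>. a \<in> \<Union>Y}" using True by auto
      ultimately show ?thesis using \<Z>(2) by (auto simp: card_insert_if)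
    next
      case False
      then have "{Y \<in> insert Z \<Z>. a \<in> \<Union>Y} = {Y \<in> \<Z>. a \<in> \<Union>Y}" by auto
      then show ?thesis using \<Z>(6)[OF a] by simp
    qed
  qed (use \<Z>(2) in simp)
qed

text \<open>There are at least (s / 2)^r / r! vertex-disjoint r-subfamilies, but each uses at most 2
  L r colours. If all colour sets were distinct, s would be at most 2 r times the left side of
  \<open>ratio\<close>, hence less than 4 L \<tau> r.\<close>

lemma regular_sub_of_cycles:
  assumes tri: "tripartite A B C E"
    and \<Z>: "finite \<Z>" "card \<Z> = s" "\<And>Z. Z \<in> \<Z> \<Longrightarrow> Z \<subseteq> E" "\<And>Z. Z \<in> \<Z> \<Longrightarrow> rainbow_cycle A (2 * L) Z"
      "\<And>Z Z'. Z \<in> \<Z> \<Longrightarrow> Z' \<in> \<Z> \<Longrightarrow> Z \<noteq> Z' \<Longrightarrow> Z \<inter> Z' = {} \<and> \<Union>Z \<inter> \<Union>Z' \<subseteq> A"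
      "\<And>a. a \<in> A \<Longrightarrow> card {Z \<in> \<Z>. a \<in> \<Union>Z} \<le> \<tau>"
    and r: "r \<ge> 1" "4 * L * \<tau> * r \<le> s" "L > 0"
    and ratio: "(3 * (real (card A) / (2 * L * r) + 1)) ^ (2 * L) < 2 * L * \<tau>"
  shows "has_regular_sub 2 E"
proof -
  define confl where "confl = (\<lambda>Y Z :: 'a set set. \<Union>Y \<inter> \<Union>Z \<noteq> {})"
  define I where "I = independent confl \<Z> r"
  define \<Phi> where "\<Phi> F = A \<inter> \<Union>(\<Union>F)" for F :: "'a set set set"
  define m where "m = 2 * L * r"
  have m: "m > 0" using r by (simp add: m_def)
  have finV: "finite A" using tri by (auto simp: tripartite_def)
  have hitA: "\<Union>Z \<inter> A \<noteq> {}" if Z: "Z \<in> \<Z>" for Z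
  proof -
    obtain f where "f \<in> Z" using \<Z>(4)[OF Z] by (auto simp: rainbow_cycle_def)
    moreover obtain a b c where "a \<in> A" "f = {a, b, c}"
      using \<open>f \<in> Z\<close> \<Z>(3)[OF Z] tripartite_edge[OF tri, of f] by blast
    ultimately show ?thesis by blast
  qed
  have count: "s ^ r \<le> card I * fact r * 2 ^ r"
    unfolding I_def \<Z>(2)[symmetric]
  proof (rule many_independent_sets[OF \<Z>(1), of _ "2 * L * \<tau>"])
    fix Z assume Z: "Z \<in> \<Z>"
    \<comment> \<open>Distinct cycles meet only in colours, so a cycle conflicts with at most \<tau>
      cycles for each of its at most 2 L colours.\<close>
    have sub: "{Y \<in> \<Z>. confl Z Y} \<subseteq> (\<Union>a\<in>\<Union>Z \<inter> A. {Y \<in> \<Z>. a \<in> \<Union>Y})"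
    proof
      fix Y assume Y: "Y \<in> {Y \<in> \<Z>. confl Z Y}"
      show "Y \<in> (\<Union>a\<in>\<Union>Z \<inter> A. {Y \<in> \<Z>. a \<in> \<Union>Y})"
      proof (cases "Y = Z")
        case True
        then show ?thesis using hitA[OF Z] Z by blast
      next
        case False
        then have "\<Union>Z \<inter> \<Union>Y \<subseteq> A" using \<Z>(5)[OF Z, of Y] Y by auto
        then show ?thesis using Y unfolding confl_def by blast
      qed
    qed
    have "card {Y \<in> \<Z>. confl Z Y} \<le> card (\<Union>a\<in>\<Union>Z \<inter> A. {Y \<in> \<Z>. a \<in> \<Union>Y})"
      using finV \<Z>(1) by (intro card_mono sub) auto
    also have "\<dots> \<le> (\<Sum>a\<in>\<Union>Z \<inter> A. card {Y \<in> \<Z>. a \<in> \<Union>Y})"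
      using finV by (intro card_UN_le) auto
    also have "\<dots> \<le> (\<Sum>a\<in>\<Union>Z \<inter> A. \<tau>)" using \<Z>(6) by (intro sum_mono) auto
    also have "\<dots> \<le> 2 * L * \<tau>" using \<Z>(4)[OF Z] by (simp add: rainbow_cycle_def)
    finally show "card {Y \<in> \<Z>. confl Z Y} \<le> 2 * L * \<tau>" .
    show "confl Z Z" using hitA[OF Z] unfolding confl_def by blast
  next
    show "confl z' z" if "confl z z'" for z z' using that by (auto simp: confl_def)
  qed (use r \<Z>(2) in \<open>auto simp: mult_ac\<close>)
  have I: "F \<subseteq> \<Z> \<and> card F = r \<and> (\<forall>Z\<in>F. \<forall>Y\<in>F. Z \<noteq> Y \<longrightarrow> \<Union>Z \<inter> \<Union>Y = {})" if "F \<in> I" for F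
    using that unfolding I_def independent_def confl_def mem_Collect_eq not_not .
  have "\<not> inj_on \<Phi> I"
  proof
    assume inj: "inj_on \<Phi> I"
    have "card I \<le> card {X. X \<subseteq> A \<and> card X \<le> m}"
    proof (rule card_inj_on_le[OF inj])
      show "\<Phi> ` I \<subseteq> {X. X \<subseteq> A \<and> card X \<le> m}"
      proof clarify
        fix F assume F: "F \<in> I"
        have finF: "finite F" using I[OF F] \<Z>(1) by (auto intro: finite_subset)
        have eq: "\<Phi> F = (\<Union>Z\<in>F. \<Union>Z \<inter> A)" by (auto simp: \<Phi>_def)
        have "card (\<Phi> F) \<le> (\<Sum>Z\<in>F. card (\<Union>Z \<inter> A))"
          unfolding eq by (rule card_UN_le[OF finF])
        also have "\<dots> \<le> (\<Sum>Z\<in>F. 2 * L)"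
          using I[OF F] \<Z>(4) by (intro sum_mono) (auto simp: rainbow_cycle_def)
        finally show "\<Phi> F \<subseteq> A \<and> card (\<Phi> F) \<le> m" using I[OF F] by (simp add: m_def \<Phi>_def mult_ac)
      qed
      show "finite {X. X \<subseteq> A \<and> card X \<le> m}" using finV by simp
    qed
    also have "\<dots> \<le> (card A + m) choose m" by (rule card_subsets_le[OF finV])
    finally have cI: "card I \<le> (card A + m) choose m" .
    \<comment> \<open>Bounding m! from below by (m / 3)^m turns (|A| + m)^m / m! into y^m.\<close>
    define y where "y = 3 * (real (card A) / m + 1)"
    have y_pos: "y \<ge> 0" by (simp add: y_def)
    have "real ((card A + m) choose m) * (real m / 3) ^ m \<le> real ((card A + m) choose m) * fact m"
      using power_self_le_fact[of m] by (intro mult_left_mono) (auto simp: power_divide field_simps)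
    also have "\<dots> = real (((card A + m) choose m) * fact m)" by simp
    also have "\<dots> \<le> real ((card A + m) ^ m)" using binomial_fact_pow by (simp only: of_nat_le_iff)
    also have "\<dots> = (y * (real m / 3)) ^ m"
    proof -
      have "y * (real m / 3) = real (card A + m)" using m by (simp add: y_def field_simps)
      then show ?thesis by (simp only: of_nat_power)
    qed
    also have "\<dots> = y ^ m * (real m / 3) ^ m" by (rule power_mult_distrib)
    finally have binom: "real ((card A + m) choose m) \<le> y ^ m" using m by (simp add: mult_le_cancel_right)
    have "real s ^ r \<le> real (card I * fact r * 2 ^ r)" using count by (metis of_nat_le_iff of_nat_power)
    also have "\<dots> = real (card I) * fact r * 2 ^ r" by simp
    also have "\<dots> \<le> y ^ m * real r ^ r * 2 ^ r"
    proof (intro mult_right_mono mult_mono)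
      show "real (card I) \<le> y ^ m" using cI binom by (meson of_nat_le_iff order_trans)
      show "fact r \<le> real r ^ r" using fact_le_power[of r, where 'a = real] by simp
    qed (use y_pos in auto)
    also have "\<dots> = (y ^ (2 * L) * (2 * real r)) ^ r"
      unfolding m_def power_mult[of y "2 * L" r] by (simp add: power_mult_distrib mult_ac)
    finally have "real s \<le> y ^ (2 * L) * (2 * real r)"
      using r y_pos by (subst (asm) power_mono_iff) auto
    moreover have "y ^ (2 * L) * (2 * real r) < (2 * L * \<tau>) * (2 * real r)"
      using ratio r by (intro mult_strict_right_mono) (auto simp: y_def m_def)
    moreover have "real (4 * L * \<tau> * r) \<le> real s" using r(2) by (simp only: of_nat_le_iff)
    ultimately show False by (simp add: mult_ac)
  qed
  then obtain F G where FG: "F \<in> I" "G \<in> I" "\<Phi> F = \<Phi> G" "F \<noteq> G" by (auto simp: inj_on_def)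
  show ?thesis
  proof (rule has_regular_sub_of_two_families[where \<Z> = \<Z> and A = A and F = F and G = G])
    show "vdegree Z v = (if v \<in> A then 1 else 2)" if "Z \<in> \<Z>" "v \<in> \<Union>Z" for Z v
      using \<Z>(4)[OF that(1)] that(2) by (auto simp: rainbow_cycle_def)
    show "Z \<noteq> {} \<and> finite Z \<and> Z \<subseteq> E" if "Z \<in> \<Z>" for Z
      using \<Z>(3,4)[OF that] by (auto simp: rainbow_cycle_def)
    show "\<Union>Z \<inter> \<Union>Z' = {}" if "Z \<in> F" "Z' \<in> F" "Z \<noteq> Z'" for Z Z' using I[OF FG(1)] that by blast
    show "\<Union>Z \<inter> \<Union>Z' = {}" if "Z \<in> G" "Z' \<in> G" "Z \<noteq> Z'" for Z Z' using I[OF FG(2)] that by blast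
  qed (use \<Z>(5) I[OF FG(1)] I[OF FG(2)] FG in \<open>auto simp: \<Phi>_def\<close>)
qed

text \<open>In the tripartite setting every edge has exactly one vertex in X, so the middle
  condition bounds \<open>D\<close> by \<Lambda> times the average degree in X.\<close>

definition balanced_part :: "'a set set \<Rightarrow> real \<Rightarrow> real \<Rightarrow> 'a set \<Rightarrow> nat \<Rightarrow> bool" where
  "balanced_part E \<Lambda> d X D \<longleftrightarrow>
     (\<forall>v\<in>X. vdegree E v \<le> D) \<and> real (card X) * real D \<le> \<Lambda> * real (card E) \<and> d \<le> real D"

text \<open>The threshold K for \<open>DA\<close> / \<open>DB\<close> separates the methods. Up to
  K, matchings suffice because \<open>DB\<close> \<open>DC\<close> > 2592 \<Lambda>^3
  \<open>DA\<close>; here 2592 = 18 * 12^2 combines the matching bound with r at least |E| / (12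
  \<open>DA\<close>). Above K, cycles suffice because \<tau> > K.\<close>

lemma regular_sub_of_sorted_parts:
  fixes \<Lambda> d :: real
  assumes tri: "tripartite A B C E" and lin: "linear_edges E" and ne: "E \<noteq> {}"
    and bal: "balanced_part E \<Lambda> d A DA" "balanced_part E \<Lambda> d B DB" "balanced_part E \<Lambda> d C DC"
    and ord: "DC \<le> DB" "DB \<le> DA" and \<Lambda>: "\<Lambda> \<ge> 1" and L: "even L" "L > 0"
    and N: "(real (card (B \<union> C)))\<^sup>2 < (d / (256 * \<Lambda>\<^sup>2 * (real L)\<^sup>2)) ^ L"
    and d: "2592 * \<Lambda> ^ 3 * (387 * real L * \<Lambda>) ^ (2 * L) < d"
  shows "has_regular_sub 2 E"
proof -
  define e where "e = real (card E)"
  define K where "K = (387 * real L * \<Lambda>) ^ (2 * L)"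
  define a b c x y z where "a = real (card A)" "b = real (card B)" "c = real (card C)"
    "x = real DA" "y = real DB" "z = real DC"
  note defs = a_b_c_x_y_z_def
  have finE: "finite E" using tri by (rule tripartite_finite)
  have e: "e > 0" using ne finE by (simp add: e_def card_gt_0_iff)
  have l: "real L \<ge> 1" using L by simp
  have base: "387 * real L * \<Lambda> \<ge> 1"
  proof -
    have "1 * 1 \<le> (387 * real L) * \<Lambda>" using l \<Lambda> by (intro mult_mono) auto
    then show ?thesis by simp
  qed
  have "(387 * real L * \<Lambda>) ^ 2 \<le> K" unfolding K_def using base L by (intro power_increasing) auto
  moreover have "(real L)\<^sup>2 * 1 \<le> (387 * real L * \<Lambda>)\<^sup>2"
    using \<Lambda> by (simp only: power_mult_distrib, intro mult_mono) auto
  ultimately have K: "(real L)\<^sup>2 \<le> K" by simp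
  have \<Lambda>23: "\<Lambda>\<^sup>2 \<le> \<Lambda> ^ 3" using \<Lambda> by (intro power_increasing) auto
  have z: "2592 * \<Lambda> ^ 3 * K < z"
    using d bal(3) by (simp add: K_def defs balanced_part_def)
  have zy: "z \<le> y" "y \<le> x" using ord by (auto simp: defs)
  have "2592 * \<Lambda> ^ 3 * K \<ge> 0" using K \<Lambda> by (intro mult_nonneg_nonneg) (auto simp: K_def)
  then have pos: "z > 0" "y > 0" "x > 0" using z zy by linarith+
  have sz: "a * x \<le> \<Lambda> * e" "b * y \<le> \<Lambda> * e" "c * z \<le> \<Lambda> * e"
    using bal by (auto simp: balanced_part_def defs e_def)
  have nn: "a \<ge> 0" "b \<ge> 0" "c \<ge> 0" by (auto simp: defs)
  \<comment> \<open>Linearity forces \<open>A\<close> to have at least y / \<Lambda> vertices. Hence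
    x y is at most \<Lambda>^2 |E|, which makes |E| large compared with x and keeps the roundings
    below harmless.\<close>
  have "e \<le> a * b" using linear_card_le[OF tri lin] unfolding e_def defs by (metis of_nat_le_iff of_nat_mult)
  then have "e * y \<le> a * (b * y)" using pos by (simp add: mult_right_mono flip: mult.assoc)
  also have "\<dots> \<le> a * (\<Lambda> * e)" using sz nn by (intro mult_left_mono) auto
  finally have "y \<le> \<Lambda> * a" using e by (simp add: mult_ac)
  then have "y * x \<le> \<Lambda> * (a * x)" using pos by (simp add: mult_right_mono flip: mult.assoc)
  also have "\<dots> \<le> \<Lambda>\<^sup>2 * e" using sz \<Lambda> by (simp add: power2_eq_square mult_left_mono)
  finally have yx: "y * x \<le> \<Lambda>\<^sup>2 * e" .
  have "\<Lambda>\<^sup>2 * (2592 * (real L)\<^sup>2 * x) = 2592 * (\<Lambda>\<^sup>2 * (real L)\<^sup>2) * x" by simp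
  also have "\<dots> \<le> 2592 * (\<Lambda> ^ 3 * K) * x"
    using \<Lambda>23 K pos \<Lambda> by (intro mult_right_mono mult_left_mono mult_mono) auto
  also have "\<dots> \<le> y * x" using z zy pos by (intro mult_right_mono) auto
  finally have "\<Lambda>\<^sup>2 * (2592 * (real L)\<^sup>2 * x) \<le> \<Lambda>\<^sup>2 * e" using yx by linarith
  then have large: "2592 * (real L)\<^sup>2 * x \<le> e" using \<Lambda> by simp
  have L2: "(real L)\<^sup>2 \<ge> 1" "(real L)\<^sup>2 \<ge> L" using l one_le_power[of "real L" 2] self_le_power[of "real L" 2] by auto
  show ?thesis
  proof (cases "x \<le> K * y")
    case True
    define r where "r = card E div (6 * DA)"
    have "6 * x * 1 \<le> 2592 * x * (real L)\<^sup>2" using L2 pos by (intro mult_mono) auto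
    then have "6 * x \<le> e" using large by (simp add: mult_ac)
    then have "real (6 * DA) \<le> real (card E)" by (simp add: e_def defs)
    then have "6 * DA \<le> card E" by (simp only: of_nat_le_iff)
    then have r1: "r \<ge> 1" unfolding r_def using pos by (simp add: defs div_greater_zero_iff Suc_le_eq)
    have r_le: "6 * r * DA \<le> card E"
      unfolding r_def by (metis div_times_less_eq_dividend mult.assoc mult.commute)
    have "card E < 6 * DA * (r + 1)" unfolding r_def using pos
      by (simp add: defs dividend_less_times_div)
    also have "\<dots> \<le> 12 * r * DA" using r1 by (simp add: algebra_simps)
    finally have "real (card E) \<le> real (12 * r * DA)" by (simp only: of_nat_le_iff)
    then have r_ge: "e \<le> 12 * r * x" by (simp add: e_def defs)
    have "18 * a * b * c < e * (real r)\<^sup>2"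
    proof (rule ccontr)
      assume "\<not> 18 * a * b * c < e * (real r)\<^sup>2"
      then have "e * (real r)\<^sup>2 \<le> 18 * a * b * c" by simp
      then have "e * (real r)\<^sup>2 * (144 * x\<^sup>2) * (y * z) \<le> 18 * a * b * c * (144 * x\<^sup>2) * (y * z)"
        using pos by (intro mult_right_mono) auto
      also have "\<dots> = 2592 * x * ((a * x) * ((b * y) * (c * z)))" by (simp add: power2_eq_square)
      also have "\<dots> \<le> 2592 * x * ((\<Lambda> * e) * ((\<Lambda> * e) * (\<Lambda> * e)))"
        by (rule mult_left_mono[OF mult_mono[OF sz(1) mult_mono[OF sz(2,3)]]])
          (use nn pos e \<Lambda> in auto)
      also have "\<dots> = e ^ 3 * (2592 * \<Lambda> ^ 3 * x)" by (simp add: power3_eq_cube)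
      finally have "e * (12 * r * x)\<^sup>2 * (y * z) \<le> e ^ 3 * (2592 * \<Lambda> ^ 3 * x)"
        by (simp add: power_mult_distrib mult_ac)
      moreover have "e * e\<^sup>2 * (y * z) \<le> e * (12 * r * x)\<^sup>2 * (y * z)"
        using r_ge e pos by (intro mult_right_mono mult_left_mono power_mono) auto
      ultimately have "e ^ 3 * (y * z) \<le> e ^ 3 * (2592 * \<Lambda> ^ 3 * x)"
        by (simp add: power3_eq_cube power2_eq_square mult_ac)
      then have "y * z \<le> 2592 * \<Lambda> ^ 3 * x" using e by simp
      also have "\<dots> \<le> 2592 * \<Lambda> ^ 3 * (K * y)" using True \<Lambda> by (intro mult_left_mono) auto
      also have "\<dots> = y * (2592 * \<Lambda> ^ 3 * K)" by simp
      also have "\<dots> < y * z" using z pos by (intro mult_strict_left_mono) auto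
      finally show False by simp
    qed
    then have many: "18 * real (card A) * real (card B) * real (card C) < real (card E) * (real r)\<^sup>2"
      by (simp add: defs e_def)
    show ?thesis
    proof (rule regular_sub_of_matchings[OF tri r1 r_le _ many])
      show "vdegree E v \<le> DA" if "v \<in> A \<union> B \<union> C" for v
        using that bal ord unfolding balanced_part_def by (meson UnE order_trans)
    qed
  next
    case False
    \<comment> \<open>Rounded up so that \<tau> \<open>DB\<close> lies between \<open>DA\<close> and
      2 \<open>DA\<close>.\<close>
    define \<tau> where "\<tau> = DA div DB + 1"
    define s where "s = card E div (8 * L * DB)"
    define r where "r = s div (4 * L * \<tau>)"
    have DB: "DB > 0" using pos by (simp add: defs)
    have \<tau>: "DA \<le> \<tau> * DB"
      unfolding \<tau>_def using DB by (simp add: dividend_less_times_div less_imp_le mult.commute)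
    have "\<tau> * DB \<le> 2 * DA" using ord div_times_less_eq_dividend[of DA DB] unfolding \<tau>_def add_mult_distrib by linarith
    then have "real (\<tau> * DB) \<le> real (2 * DA)" by (simp only: of_nat_le_iff)
    then have \<tau>2: "\<tau> * y \<le> 2 * x" by (simp add: defs)
    have "real DA \<le> real (\<tau> * DB)" using \<tau> by (simp only: of_nat_le_iff)
    then have \<tau>1: "x \<le> \<tau> * y" by (simp add: defs)
    have s_le: "8 * L * s * DB \<le> card E"
      unfolding s_def by (metis div_times_less_eq_dividend mult.assoc mult.commute)
    have "card E < 8 * L * DB * (s + 1)" unfolding s_def using DB L by (simp add: dividend_less_times_div)
    then have "real (card E) \<le> real (8 * L * DB * (s + 1))" by (simp only: of_nat_le_iff less_imp_le)
    then have "e \<le> 8 * L * y * s + 8 * L * y" by (simp add: e_def defs algebra_simps)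
    moreover have "16 * L * y \<le> 2592 * (real L)\<^sup>2 * x"
      by (intro mult_mono) (use L2 zy pos in linarith)+
    ultimately have s_ge: "e \<le> 16 * L * y * s" using large by linarith
    have "81 * (real L * \<tau>) * (16 * real L * y) = 1296 * (real L)\<^sup>2 * (\<tau> * y)"
      by (simp add: power2_eq_square)
    also have "\<dots> \<le> 1296 * (real L)\<^sup>2 * (2 * x)" using \<tau>2 by (intro mult_left_mono) auto
    also have "\<dots> \<le> e" using large by simp
    also have "\<dots> \<le> real s * (16 * real L * y)" using s_ge by (simp add: mult_ac)
    finally have "81 * (real L * \<tau>) \<le> s" using l pos by simp
    then have "real (4 * L * \<tau>) \<le> real s" by simp
    then have "4 * L * \<tau> \<le> s" by (simp only: of_nat_le_iff)
    then have r1: "r \<ge> 1" unfolding r_def using L by (simp add: \<tau>_def div_greater_zero_iff Suc_le_eq)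
    have r_le: "4 * L * \<tau> * r \<le> s" unfolding r_def by simp
    have "s < 4 * L * \<tau> * (r + 1)" unfolding r_def using L by (simp add: \<tau>_def dividend_less_times_div)
    also have "\<dots> \<le> 8 * L * \<tau> * r" using r1 by (simp add: algebra_simps)
    finally have "real s \<le> real (8 * L * \<tau> * r)" by (simp only: of_nat_le_iff)
    then have r_ge: "real s \<le> 8 * L * \<tau> * r" by simp
    have "a * x \<le> \<Lambda> * e" by (rule sz)
    also have "\<dots> \<le> \<Lambda> * (16 * L * y * s)" using s_ge \<Lambda> by (intro mult_left_mono) auto
    also have "\<dots> \<le> \<Lambda> * (16 * L * y * (8 * L * \<tau> * r))"
      using r_ge \<Lambda> pos by (intro mult_left_mono) auto
    also have "\<dots> = 128 * \<Lambda> * (real L)\<^sup>2 * r * (\<tau> * y)" by (simp add: power2_eq_square)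
    also have "\<dots> \<le> 128 * \<Lambda> * (real L)\<^sup>2 * r * (2 * x)"
      using \<tau>2 \<Lambda> by (intro mult_left_mono) auto
    also have "\<dots> = (256 * \<Lambda> * (real L)\<^sup>2 * r) * x" by simp
    finally have "a \<le> 256 * \<Lambda> * (real L)\<^sup>2 * r" using pos by (simp only: mult_le_cancel_right_pos)
    also have "\<dots> = (128 * real L * \<Lambda>) * (2 * real L * real r)" by (simp add: power2_eq_square)
    finally have "a / (2 * real L * real r) \<le> 128 * real L * \<Lambda>"
      using l r1 by (simp add: pos_divide_le_eq)
    moreover have "1 * 1 \<le> real L * \<Lambda>" using l \<Lambda> by (intro mult_mono) auto
    \<comment> \<open>The origin of 387, which is 3 * (128 + 1).\<close>
    ultimately have "3 * (a / (2 * real L * real r) + 1) \<le> 387 * real L * \<Lambda>" by simp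
    then have "(3 * (a / (2 * real L * real r) + 1)) ^ (2 * L) \<le> K"
      unfolding K_def using nn by (intro power_mono) auto
    also have "K < \<tau>"
    proof -
      have "K * y < \<tau> * y" using False \<tau>1 by linarith
      then show ?thesis using pos by simp
    qed
    also have "real \<tau> \<le> 2 * real L * \<tau>"
      using mult_right_mono[of 1 "2 * real L" "real \<tau>"] l by linarith
    finally have ratio: "(3 * (real (card A) / real (2 * L * r) + 1)) ^ (2 * L) < real (2 * L * \<tau>)"
      by (simp add: defs)
    have N': "(real (card (B \<union> C)))\<^sup>2 < (real DC / (256 * \<Lambda>\<^sup>2 * (real L)\<^sup>2)) ^ L"
    proof -
      have "0 \<le> d" using \<open>2592 * \<Lambda> ^ 3 * K \<ge> 0\<close> d unfolding K_def by linarith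
      then have "(d / (256 * \<Lambda>\<^sup>2 * (real L)\<^sup>2)) ^ L \<le> (real DC / (256 * \<Lambda>\<^sup>2 * (real L)\<^sup>2)) ^ L"
        using bal(3) by (intro power_mono divide_right_mono) (auto simp: balanced_part_def)
      then show ?thesis using N by linarith
    qed
    have "\<exists>\<Z>. card \<Z> = s \<and> finite \<Z> \<and> (\<forall>Z\<in>\<Z>. Z \<subseteq> E \<and> rainbow_cycle A (2 * L) Z)
     \<and> (\<forall>Z\<in>\<Z>. \<forall>Z'\<in>\<Z>. Z \<noteq> Z' \<longrightarrow> Z \<inter> Z' = {} \<and> \<Union>Z \<inter> \<Union>Z' \<subseteq> A)
     \<and> (\<forall>a\<in>A. card {Z \<in> \<Z>. a \<in> \<Union>Z} \<le> \<tau>)"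
    proof (rule greedy_rainbow_cycles[OF tri lin ne _ _ _ _ _ ord(1) \<tau> DB _ L N' s_le])
      show "vdegree E v \<le> DA" if "v \<in> A" for v using that bal unfolding balanced_part_def by blast
      show "vdegree E v \<le> DB" if "v \<in> B" for v using that bal unfolding balanced_part_def by blast
      show "vdegree E v \<le> DC" if "v \<in> C" for v using that bal unfolding balanced_part_def by blast
      show "real (card B) * real DB \<le> \<Lambda> * real (card E)" using bal unfolding balanced_part_def by blast
      show "real (card C) * real DC \<le> \<Lambda> * real (card E)" using bal unfolding balanced_part_def by blast
    qed (use \<Lambda> in auto)
    then obtain \<Z> where \<Z>: "card \<Z> = s" "finite \<Z>"
      "\<forall>Z\<in>\<Z>. Z \<subseteq> E \<and> rainbow_cycle A (2 * L) Z"
      "\<forall>Z\<in>\<Z>. \<forall>Z'\<in>\<Z>. Z \<noteq> Z' \<longrightarrow> Z \<inter> Z' = {} \<and> \<Union>Z \<inter> \<Union>Z' \<subseteq> A"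
      "\<forall>a\<in>A. card {Z \<in> \<Z>. a \<in> \<Union>Z} \<le> \<tau>"
      by (elim exE conjE) (rule that)
    show ?thesis
      by (rule regular_sub_of_cycles[OF tri \<Z>(2,1) _ _ _ _ r1 r_le L(2) ratio])
        (use bspec[OF \<Z>(3)] bspec[OF bspec[OF \<Z>(4)]] bspec[OF \<Z>(5)] in \<open>simp_all del: Union_iff\<close>)
  qed
qed

text \<open>The hypotheses are symmetric in the parts, so they may be sorted by degree;
  \<open>N\<close> uses all three parts to cover whichever two serve as vertices of the coloured
  graph.\<close>

lemma regular_sub_of_balanced_parts:
  fixes \<Lambda> d :: real
  assumes tri: "tripartite A B C E" and lin: "linear_edges E" and ne: "E \<noteq> {}"
    and bal: "balanced_part E \<Lambda> d A DA" "balanced_part E \<Lambda> d B DB" "balanced_part E \<Lambda> d C DC"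
    and \<Lambda>: "\<Lambda> \<ge> 1" and L: "even L" "L > 0"
    and N: "(real (card (A \<union> B \<union> C)))\<^sup>2 < (d / (256 * \<Lambda>\<^sup>2 * (real L)\<^sup>2)) ^ L"
    and d: "2592 * \<Lambda> ^ 3 * (387 * real L * \<Lambda>) ^ (2 * L) < d"
  shows "has_regular_sub 2 E"
proof -
  have finV: "finite (A \<union> B \<union> C)" using tri by (auto simp: tripartite_def)
  have N': "(real (card U))\<^sup>2 < (d / (256 * \<Lambda>\<^sup>2 * (real L)\<^sup>2)) ^ L" if "U \<subseteq> A \<union> B \<union> C" for U
  proof -
    have "card U \<le> card (A \<union> B \<union> C)" using that finV by (intro card_mono) auto
    then have "(real (card U))\<^sup>2 \<le> (real (card (A \<union> B \<union> C)))\<^sup>2" by (intro power_mono) auto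
    then show ?thesis using N by linarith
  qed
  note sorted = regular_sub_of_sorted_parts[OF _ lin ne _ _ _ _ _ \<Lambda> L _ d]
  note tris = tri tripartite_swap[OF tri] tripartite_rotate[OF tri] tripartite_swap[OF tripartite_rotate[OF tri]]
    tripartite_rotate[OF tripartite_rotate[OF tri]]
    tripartite_swap[OF tripartite_rotate[OF tripartite_rotate[OF tri]]]
  consider "DC \<le> DB" "DB \<le> DA" | "DB \<le> DC" "DC \<le> DA" | "DA \<le> DC" "DC \<le> DB"
    | "DC \<le> DA" "DA \<le> DB" | "DB \<le> DA" "DA \<le> DC" | "DA \<le> DB" "DB \<le> DC"
    by linarith
  then show ?thesis
  proof cases
    case 1 show ?thesis by (rule sorted[OF tris(1) bal(1,2,3) 1 N']) auto
  next
    case 2 show ?thesis by (rule sorted[OF tris(2) bal(1,3,2) 2 N']) auto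
  next
    case 3 show ?thesis by (rule sorted[OF tris(3) bal(2,3,1) 3 N']) auto
  next
    case 4 show ?thesis by (rule sorted[OF tris(4) bal(2,1,3) 4 N']) auto
  next
    case 5 show ?thesis by (rule sorted[OF tris(5) bal(3,1,2) 5 N']) auto
  next
    case 6 show ?thesis by (rule sorted[OF tris(6) bal(3,2,1) 6 N']) auto
  qed
qed

section \<open>Passing to degree classes\<close>

text \<open>Edges through v are disjoint outside v, so choosing another vertex from each is
  injective. This bounds the number of dyadic degree classes.\<close>

lemma vdegree_less_card:
  assumes "linear_3graph V E" "v \<in> V"
  shows "vdegree E v < card V"
proof -
  have lin: "linear_edges E" and finV: "finite V" and sub: "\<And>e. e \<in> E \<Longrightarrow> e \<subseteq> V"
    and card3: "\<And>e. e \<in> E \<Longrightarrow> card e = 3"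
    using assms by (auto simp: linear_3graph_def hypergraph_def uniform_edges_def)
  have ex: "\<exists>u. u \<in> e \<and> u \<noteq> v" if e: "e \<in> E" for e
  proof (rule ccontr)
    assume "\<not> ?thesis"
    then have "e \<subseteq> {v}" by auto
    then have "card e \<le> card {v}" by (intro card_mono) auto
    then show False using card3[OF e] by simp
  qed
  then obtain g where g: "\<And>e. e \<in> E \<Longrightarrow> g e \<in> e \<and> g e \<noteq> v" by metis
  have "card {e \<in> E. v \<in> e} \<le> card (V - {v})"
  proof (rule card_inj_on_le)
    show "inj_on g {e \<in> E. v \<in> e}"
    proof (rule inj_onI)
      fix e f assume *: "e \<in> {e \<in> E. v \<in> e}" "f \<in> {e \<in> E. v \<in> e}" "g e = g f"
      then have "finite e" using card3[of e] by (auto intro: card_ge_0_finite)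
      then show "e = f"
        using linear_edges_two_points[OF lin, of e f "g e" v] * g[of e] g[of f] by auto
    qed
    show "g ` {e \<in> E. v \<in> e} \<subseteq> V - {v}" using g sub by blast
  qed (use finV in auto)
  also have "\<dots> < card V" using assms(2) finV by (intro psubset_card_mono) auto
  finally show ?thesis by (simp add: vdegree_def)
qed

lemma sum_vdegree:
  assumes "finite V" "finite E" "\<And>e. e \<in> E \<Longrightarrow> e \<subseteq> V \<and> card e = k"
  shows "(\<Sum>v\<in>V. vdegree E v) = k * card E"
proof -
  have "(\<Sum>v\<in>V. vdegree E v) = (\<Sum>v\<in>V. \<Sum>e\<in>E. of_bool (v \<in> e))"
    unfolding vdegree_def by (intro sum.cong refl card_filter_eq_sum assms(2))
  also have "\<dots> = (\<Sum>e\<in>E. \<Sum>v\<in>V. of_bool (v \<in> e))" by (rule sum.swap)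
  also have "\<dots> = (\<Sum>e\<in>E. k)"
  proof (intro sum.cong refl)
    fix e assume "e \<in> E"
    then have "{v \<in> V. v \<in> e} = e" "card e = k" using assms(3) by auto
    then show "(\<Sum>v\<in>V. of_bool (v \<in> e)) = k"
      using card_filter_eq_sum[OF assms(1), of "\<lambda>v. v \<in> e"] by simp
  qed
  finally show ?thesis by simp
qed

lemma separating_bits:
  fixes f :: "'a \<Rightarrow> nat"
  assumes f: "inj_on f V" "\<And>v. v \<in> V \<Longrightarrow> f v < 2 ^ m"
    and xy: "x \<in> V" "y \<in> V" "x \<noteq> y"
  shows "\<exists>t<m. bit (f x) t \<noteq> bit (f y) t"
proof (rule ccontr)
  assume not: "\<not> ?thesis"
  have "bit (f x) t = bit (f y) t" for t
  proof (cases "t < m")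
    case False
    then have "take_bit m (f x) = f x" "take_bit m (f y) = f y"
      using f(2) xy by (auto simp: take_bit_nat_eq_self)
    then show ?thesis using False by (metis bit_take_bit_iff)
  qed (use not in blast)
  then have "f x = f y" by (intro bit_eqI) auto
  then show False using f(1) xy by (auto simp: inj_on_def)
qed

text \<open>Derandomised choice of a tripartition: its parts are cut out by two bit positions.\<close>

lemma bits_split_triple:
  fixes f :: "'a \<Rightarrow> nat"
  assumes f: "inj_on f V" "\<And>v. v \<in> V \<Longrightarrow> f v < 2 ^ m"
    and e: "e \<subseteq> V" "card e = 3"
  shows "\<exists>a b c t t' \<sigma>. e = {a, b, c} \<and> t < m \<and> t' < m \<and> bit (f a) t = \<sigma> \<and> bit (f b) t = (\<not> \<sigma>)
    \<and> bit (f c) t = (\<not> \<sigma>) \<and> bit (f b) t' \<and> \<not> bit (f c) t'"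
proof -
  obtain x y z where xyz: "e = {x, y, z}" "x \<noteq> y" "x \<noteq> z" "y \<noteq> z"
    using e(2) by (auto simp: card_3_iff)
  have in_V: "x \<in> V" "y \<in> V" "z \<in> V" using xyz e by auto
  obtain t where t: "t < m" "bit (f x) t \<noteq> bit (f y) t"
    using separating_bits[OF f in_V(1,2) xyz(2)] by blast
  \<comment> \<open>At bit t one vertex of the triple differs from the other two; it becomes a, and
    a second bit separates b from c.\<close>
  have key: ?thesis
    if abc: "e = {a, b, c}" "b \<in> V" "c \<in> V" "b \<noteq> c" "bit (f b) t = (\<not> bit (f a) t)" "bit (f c) t = (\<not> bit (f a) t)"
    for a b c
  proof -
    obtain t' where t': "t' < m" "bit (f b) t' \<noteq> bit (f c) t'"
      using separating_bits[OF f abc(2-4)] by blast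
    show ?thesis
    proof (cases "bit (f b) t'")
      case True
      then show ?thesis using abc t t' by blast
    next
      case False
      have "e = {a, c, b}" using abc(1) by auto
      then show ?thesis using abc t t' False by blast
    qed
  qed
  show ?thesis
  proof (cases "bit (f z) t = bit (f x) t")
    case True
    have "e = {y, x, z}" using xyz by auto
    then show ?thesis using key[of y x z] in_V xyz t True by blast
  next
    case False
    then show ?thesis using key[of x y z] in_V xyz t by blast
  qed
qed

text \<open>Pigeonhole over two bit positions, the bit value of the first part and three degree
  classes, 2 m^5 choices in all. The classes refer to degrees in \<open>E\<close>: these bound the
  degrees in the subgraph from above, and the handshake identity in \<open>E\<close> bounds the part
  sizes.\<close>

lemma balanced_subgraph:
  assumes graph: "linear_3graph V E" and ne: "E \<noteq> {}" and m: "card V \<le> 2 ^ m"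
    and d: "2 * real m ^ 5 * real (card V) * d \<le> real (card E)"
  shows "\<exists>E' A B C DA DB DC. E' \<subseteq> E \<and> E' \<noteq> {} \<and> A \<union> B \<union> C \<subseteq> V \<and> tripartite A B C E'
    \<and> balanced_part E' (12 * real m ^ 5) d A DA \<and> balanced_part E' (12 * real m ^ 5) d B DB
    \<and> balanced_part E' (12 * real m ^ 5) d C DC"
proof -
  have finV: "finite V" and sub: "\<And>e. e \<in> E \<Longrightarrow> e \<subseteq> V" and card3: "\<And>e. e \<in> E \<Longrightarrow> card e = 3"
    using graph by (auto simp: linear_3graph_def hypergraph_def uniform_edges_def)
  have finE: "finite E" using finV sub by (intro finite_subset[of E "Pow V"]) auto
  obtain f where "bij_betw f V {0..<card V}" using ex_bij_betw_finite_nat[OF finV] by blast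
  then have f: "inj_on f V" "\<And>v. v \<in> V \<Longrightarrow> f v < 2 ^ m"
    using m by (auto simp: bij_betw_def) (metis atLeastLessThan_iff imageI order_less_le_trans)
  define cls where "cls i v \<longleftrightarrow> 2 ^ i \<le> vdegree E v \<and> vdegree E v < 2 ^ (i + 1)" for i v
  have cls_ex: "\<exists>i<m. cls i v" if v: "v \<in> e" "e \<in> E" for e v
  proof -
    have "{e \<in> E. v \<in> e} \<noteq> {}" using v by blast
    then have "1 \<le> vdegree E v" using finE by (simp add: vdegree_def Suc_le_eq card_gt_0_iff)
    then obtain i where i: "2 ^ i \<le> vdegree E v" "vdegree E v < 2 ^ (i + 1)"
      using ex_power_ivl1[of 2 "vdegree E v"] by auto
    have "v \<in> V" using sub v by blast
    then have "(2::nat) ^ i < 2 ^ m" using vdegree_less_card[OF graph, of v] i m by linarith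
    then have "i < m" by simp
    then show ?thesis using i by (auto simp: cls_def)
  qed
  define A where "A = (\<lambda>(t, \<sigma>, t' :: nat, i, j :: nat, k :: nat). {v \<in> V. bit (f v) t = \<sigma> \<and> cls i v})"
  define B where "B = (\<lambda>(t, \<sigma>, t', i :: nat, j, k :: nat). {v \<in> V. bit (f v) t = (\<not> \<sigma>) \<and> bit (f v) t' \<and> cls j v})"
  define C where "C = (\<lambda>(t, \<sigma>, t', i :: nat, j :: nat, k). {v \<in> V. bit (f v) t = (\<not> \<sigma>) \<and> \<not> bit (f v) t' \<and> cls k v})"
  define T where "T = {..<m} \<times> (UNIV :: bool set) \<times> {..<m} \<times> {..<m} \<times> {..<m} \<times> {..<m}"
  define H where "H p = {e \<in> E. \<exists>a\<in>A p. \<exists>b\<in>B p. \<exists>c\<in>C p. e = {a, b, c}}" for p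
  have finT: "finite T" by (simp add: T_def)
  have cardT: "card T = 2 * m ^ 5"
    by (simp add: T_def card_cartesian_product eval_nat_numeral mult_ac)
  have "E \<subseteq> (\<Union>p\<in>T. H p)"
  proof
    fix e assume e: "e \<in> E"
    obtain a b c t t' \<sigma> where s: "e = {a, b, c}" "t < m" "t' < m" "bit (f a) t = \<sigma>" "bit (f b) t = (\<not> \<sigma>)"
        "bit (f c) t = (\<not> \<sigma>)" "bit (f b) t'" "\<not> bit (f c) t'"
      using bits_split_triple[OF f sub[OF e] card3[OF e]] by blast
    obtain i j k where c: "i < m" "cls i a" "j < m" "cls j b" "k < m" "cls k c"
      using cls_ex[of a e] cls_ex[of b e] cls_ex[of c e] e s(1) by auto
    have "a \<in> V" "b \<in> V" "c \<in> V" using sub[OF e] s(1) by auto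
    then have "a \<in> A (t, \<sigma>, t', i, j, k)" "b \<in> B (t, \<sigma>, t', i, j, k)" "c \<in> C (t, \<sigma>, t', i, j, k)"
      using s c by (auto simp: A_def B_def C_def)
    then have "e \<in> H (t, \<sigma>, t', i, j, k)" using e s(1) unfolding H_def by blast
    moreover have "(t, \<sigma>, t', i, j, k) \<in> T" using s c by (simp add: T_def)
    ultimately show "e \<in> (\<Union>p\<in>T. H p)" by blast
  qed
  then have "card E \<le> card (\<Union>p\<in>T. H p)"
    using finT finE by (intro card_mono) (auto simp: H_def)
  also have "\<dots> \<le> (\<Sum>p\<in>T. card (H p))" by (rule card_UN_le[OF finT])
  finally have total: "card E \<le> (\<Sum>p\<in>T. card (H p))" .
  have "\<exists>p\<in>T. card E \<le> card T * card (H p)"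
  proof (rule ccontr)
    assume "\<not> ?thesis"
    then have less: "card T * card (H p) < card E" if "p \<in> T" for p using that by force
    have "T \<noteq> {}" using total ne finE by auto
    then have "(\<Sum>p\<in>T. card T * card (H p)) < (\<Sum>p\<in>T. card E)"
      using finT less by (intro sum_strict_mono) auto
    then have "card T * (\<Sum>p\<in>T. card (H p)) < card T * card E" by (simp add: sum_distrib_left)
    then show False using total by (meson mult_le_mono2 not_le)
  qed
  then obtain t \<sigma> t' i j k where p: "card E \<le> card T * card (H (t, \<sigma>, t', i, j, k))"
    unfolding Bex_def split_paired_Ex by blast
  define p where "p = (t, \<sigma>, t', i, j, k)"
  have cardE: "real (card E) \<le> 2 * real m ^ 5 * card (H p)"
    using p unfolding cardT p_def[symmetric] by (metis (mono_tags, lifting) of_nat_le_iff of_nat_mult of_nat_numeral of_nat_power)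
  have H_sub: "H p \<subseteq> E" by (auto simp: H_def)
  have H_ne: "H p \<noteq> {}" using cardE ne finE by (auto simp: card_gt_0_iff)
  have tri: "tripartite (A p) (B p) (C p) (H p)"
    using finV unfolding tripartite_def by (auto simp: A_def B_def C_def p_def H_def)
  have part: "balanced_part (H p) (12 * real m ^ 5) d X (2 ^ (l + 1))"
    if X: "X \<subseteq> V" "\<And>v. v \<in> X \<Longrightarrow> cls l v" "\<And>e. e \<in> H p \<Longrightarrow> e \<inter> X \<noteq> {}" for X l
    unfolding balanced_part_def
  proof (intro conjI ballI)
    have finX: "finite X" using X finV by (auto intro: finite_subset)
    show deg: "vdegree (H p) v \<le> 2 ^ (l + 1)" if "v \<in> X" for v
    proof -
      have "vdegree (H p) v \<le> vdegree E v"
        unfolding vdegree_def using H_sub finE by (intro card_mono) auto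
      then show ?thesis using X(2)[OF that] by (simp add: cls_def)
    qed
    \<comment> \<open>The factor 12 is 2 (width of a dyadic class) times 3 (handshake) times 2
      (choices of \<sigma>).\<close>
    have "card X * 2 ^ l = (\<Sum>v\<in>X. 2 ^ l)" by simp
    also have "\<dots> \<le> (\<Sum>v\<in>X. vdegree E v)" using X(2) by (intro sum_mono) (auto simp: cls_def)
    also have "\<dots> \<le> (\<Sum>v\<in>V. vdegree E v)" using X finV by (intro sum_mono2) auto
    also have "\<dots> = 3 * card E" using finV finE sub card3 by (intro sum_vdegree) auto
    finally have "real (card X * 2 ^ l) \<le> real (3 * card E)" by (simp only: of_nat_le_iff)
    then have "real (card X) * 2 ^ l \<le> 3 * real (card E)" by simp
    moreover have "real (card X) * real (2 ^ (l + 1)) = 2 * (real (card X) * 2 ^ l)" by simp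
    ultimately show "real (card X) * real (2 ^ (l + 1)) \<le> 12 * real m ^ 5 * real (card (H p))"
      using cardE by linarith
    \<comment> \<open>Every edge of \<open>H p\<close> meets X, so few edges would remain if the
      class degree were below d.\<close>
    have "card (H p) = card {e \<in> H p. e \<inter> X \<noteq> {}}" using X(3) by (intro arg_cong[of _ _ card]) auto
    also have "\<dots> \<le> card X * 2 ^ (l + 1)" using finX deg by (intro card_edges_meeting) auto
    also have "\<dots> \<le> card V * 2 ^ (l + 1)" using X finV by (intro mult_right_mono card_mono) auto
    finally have "real (card (H p)) \<le> real (card V * 2 ^ (l + 1))" by (simp only: of_nat_le_iff)
    then have "real (card (H p)) \<le> real (card V) * 2 ^ (l + 1)" by simp
    then have "2 * real m ^ 5 * real (card (H p)) \<le> 2 * real m ^ 5 * (real (card V) * 2 ^ (l + 1))"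
      by (intro mult_left_mono) auto
    then have le: "(2 * real m ^ 5 * real (card V)) * d \<le> (2 * real m ^ 5 * real (card V)) * 2 ^ (l + 1)"
      using cardE d unfolding mult.assoc by linarith
    have "m \<noteq> 0" using cardE ne finE by (cases m) (auto simp: card_gt_0_iff)
    moreover have "card V \<noteq> 0" using ne sub card3 finV by force
    ultimately have "0 < 2 * real m ^ 5 * real (card V)" by simp
    then show "d \<le> real (2 ^ (l + 1))" using le by (simp only: mult_le_cancel_left_pos of_nat_power of_nat_numeral)
  qed
  have meets: "e \<inter> A p \<noteq> {}" "e \<inter> B p \<noteq> {}" "e \<inter> C p \<noteq> {}" if "e \<in> H p" for e
    using that unfolding H_def by blast+
  have "balanced_part (H p) (12 * real m ^ 5) d (A p) (2 ^ (i + 1))"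
    by (rule part[OF _ _ meets(1)]) (auto simp: A_def p_def)
  moreover have "balanced_part (H p) (12 * real m ^ 5) d (B p) (2 ^ (j + 1))"
    by (rule part[OF _ _ meets(2)]) (auto simp: B_def p_def)
  moreover have "balanced_part (H p) (12 * real m ^ 5) d (C p) (2 ^ (k + 1))"
    by (rule part[OF _ _ meets(3)]) (auto simp: C_def p_def)
  moreover have "A p \<union> B p \<union> C p \<subseteq> V" by (auto simp: A_def B_def C_def p_def)
  ultimately show ?thesis using H_sub H_ne tri by blast
qed

lemma has_regular_sub_mono: "has_regular_sub r E' \<Longrightarrow> E' \<subseteq> E \<Longrightarrow> has_regular_sub r E"
  unfolding has_regular_sub_def by (meson subset_trans)

lemma regular_sub_of_many_edges:
  fixes d :: real
  assumes graph: "linear_3graph V E" and m: "card V \<le> 2 ^ m" "m \<ge> 1" and L: "even L" "L > 0"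
    and edges: "2 * real m ^ 5 * real (card V) * d \<le> real (card E)" "E \<noteq> {}"
    and N: "(real (card V))\<^sup>2 < (d / (256 * (12 * real m ^ 5)\<^sup>2 * (real L)\<^sup>2)) ^ L"
    and d: "2592 * (12 * real m ^ 5) ^ 3 * (387 * real L * (12 * real m ^ 5)) ^ (2 * L) < d"
  shows "has_regular_sub 2 E"
proof -
  have finV: "finite V" and lin: "linear_edges E"
    using graph by (auto simp: linear_3graph_def hypergraph_def)
  obtain E' A B C DA DB DC where E': "E' \<subseteq> E" "E' \<noteq> {}" "A \<union> B \<union> C \<subseteq> V" "tripartite A B C E'"
    and bal: "balanced_part E' (12 * real m ^ 5) d A DA" "balanced_part E' (12 * real m ^ 5) d B DB"
      "balanced_part E' (12 * real m ^ 5) d C DC"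
    using balanced_subgraph[OF graph edges(2) m(1) edges(1)] by blast
  have "1 \<le> real m ^ 5" using m by (intro one_le_power) simp
  then have \<Lambda>: "1 \<le> 12 * real m ^ 5" by simp
  have "card (A \<union> B \<union> C) \<le> card V" using E' finV by (intro card_mono) auto
  then have "(real (card (A \<union> B \<union> C)))\<^sup>2 \<le> (real (card V))\<^sup>2" by (intro power_mono) auto
  then have N': "(real (card (A \<union> B \<union> C)))\<^sup>2 < (d / (256 * (12 * real m ^ 5)\<^sup>2 * (real L)\<^sup>2)) ^ L"
    using N by linarith
  have "has_regular_sub 2 E'"
    by (rule regular_sub_of_balanced_parts[OF E'(4) linear_edges_mono[OF lin E'(1)] E'(2) bal \<Lambda> L N' d])
  then show ?thesis using E'(1) by (rule has_regular_sub_mono)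
qed

section \<open>Choice of parameters\<close>

text \<open>All constants and polylogarithmic factors are absorbed into powers of x = ln n, using x
  at least 2. As y is at most s, x^k is at most exp(k s); raised to a power of order L it is still
  exp(O(s)), since L y is at most 4 s.\<close>

lemma regular_sub_of_large_graph:
  fixes V :: "'a set"
  assumes graph: "linear_3graph V E" and n: "card V = n" "n \<ge> 16"
    and edges: "real n * exp (416 * sqrt (ln (real n) * ln (ln (real n)))) \<le> real (card E)"
  shows "has_regular_sub 2 E"
proof -
  define x y where "x = ln (real n)" and "y = ln x"
  define s u where "s = sqrt (x * y)" and "u = sqrt (x / y)"
  have ln2: "ln (2::real) \<ge> 2 / 3" by (rule ln2_ge_two_thirds)
  have "ln (real 16) \<le> x" unfolding x_def using n by (subst ln_le_cancel_iff) auto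
  moreover have "ln (real 16) = 4 * ln 2" using ln_realpow[of 2 4] by simp
  ultimately have x2: "x \<ge> 2" using ln2 by linarith
  have "ln 2 \<le> y" unfolding y_def using x2 by (subst ln_le_cancel_iff) auto
  then have y: "y \<ge> 2 / 3" using ln2 by linarith
  have yx: "y \<le> x" unfolding y_def using ln_le_minus_one[of x] x2 by linarith
  have su: "u * y = s" "s * u = x" and ys: "y \<le> s"
  proof -
    have "u * y = sqrt (x / y) * sqrt (y\<^sup>2)" using y by (simp add: u_def)
    also have "\<dots> = sqrt (x / y * y\<^sup>2)" by (simp only: real_sqrt_mult)
    also have "x / y * y\<^sup>2 = x * y" using y by (simp add: power2_eq_square)
    finally show "u * y = s" by (simp add: s_def)
    have "s * u = sqrt (x * y * (x / y))" by (simp only: s_def u_def real_sqrt_mult)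
    also have "x * y * (x / y) = x\<^sup>2" using y by (simp add: power2_eq_square)
    finally show "s * u = x" using x2 by simp
    have "y = sqrt (y * y)" using y by simp
    also have "\<dots> \<le> s" unfolding s_def using yx y by (intro real_sqrt_le_mono mult_right_mono) auto
    finally show "y \<le> s" .
  qed
  have s_pos: "s > 0" using ys y by linarith
  have u1: "u \<ge> 1" unfolding u_def using yx y by (simp add: pos_le_divide_eq)
  have u_le: "u \<le> x"
  proof -
    have "x * 1 \<le> x * (y * x)" using y x2 mult_mono[of "2/3" y 2 x] by (intro mult_left_mono) auto
    then have "x / y \<le> x\<^sup>2" using y by (simp add: pos_divide_le_eq power2_eq_square mult_ac)
    then show ?thesis unfolding u_def using x2 by (intro real_le_lsqrt) auto
  qed
  have pow: "2 ^ k \<le> x ^ k" for k using x2 by (intro power_mono) auto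
  have xpow: "x ^ k = exp (k * y)" for k
    using x2 by (simp add: y_def exp_of_nat_mult)
  have xpow_s: "x ^ k \<le> exp (k * s)" for k
    unfolding xpow using ys by (intro exp_mono mult_left_mono) auto
  obtain m where m: "card V \<le> 2 ^ m" "m \<ge> 1" "real m \<le> 3 * x"
  proof -
    obtain k where k: "2 ^ k < n" "n \<le> 2 ^ (k + 1)" using ex_power_ivl2[of 2 n] n by auto
    have "real (2 ^ k) \<le> real n" using k by (simp only: of_nat_le_iff less_imp_le)
    then have "ln (2 ^ k) \<le> x" unfolding x_def using n by (subst ln_le_cancel_iff) auto
    then have "k * ln 2 \<le> x" by (simp add: ln_realpow)
    moreover have "k * (2 / 3) \<le> k * ln 2" using ln2 by (intro mult_left_mono) auto
    ultimately have "real (k + 1) \<le> 3 * x" using x2 by simp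
    then show ?thesis using k n by (intro that[of "k + 1"]) auto
  qed
  \<comment> \<open>An even number of order u; then s L is at least 2 x while L y is at most 4
    s.\<close>
  define L where "L = 2 * nat \<lceil>u\<rceil>"
  have "real (nat \<lceil>u\<rceil>) = of_int \<lceil>u\<rceil>" using u1 by simp
  then have L: "2 * u \<le> L" "L \<le> 4 * u" "even L" "L > 0"
    using u1 by (auto simp: L_def) linarith+
  have m_x: "real m \<le> x ^ 3"
  proof -
    have "3 * x \<le> x ^ 2 * x" using pow[of 2] x2 by (intro mult_right_mono) auto
    then show ?thesis using m(3) by (simp add: eval_nat_numeral mult_ac)
  qed
  have L_x: "real L \<le> x ^ 3"
  proof -
    have "4 * u \<le> x ^ 2 * x" using pow[of 2] x2 u_le u1 by (intro mult_mono) auto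
    then show ?thesis using L(2) by (simp add: eval_nat_numeral mult_ac)
  qed
  define \<Lambda> where "\<Lambda> = 12 * real m ^ 5"
  have m5: "real m ^ 5 \<le> x ^ 15" using power_mono[OF m_x, of 5] by (simp flip: power_mult)
  have \<Lambda>_x: "\<Lambda> \<le> x ^ 19"
  proof -
    have "\<Lambda> \<le> x ^ 4 * x ^ 15" unfolding \<Lambda>_def using pow[of 4] m5 x2 by (intro mult_mono) auto
    then show ?thesis by (simp flip: power_add)
  qed
  have \<Lambda>_pos: "\<Lambda> > 0" using m by (simp add: \<Lambda>_def)
  \<comment> \<open>400 exceeds 317 = 69 + 248, required by the degree threshold, and leaves 348
    after the loss of 52 in the cycle criterion. The edge bound has 416 = 400 + 16, where 16 pays
    for the passage to a balanced subgraph.\<close>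
  define d where "d = exp (400 * s)"
  show ?thesis
  proof (rule regular_sub_of_many_edges[OF graph m(1,2) L(3,4)])
    have "2 * real m ^ 5 \<le> x ^ 1 * x ^ 15" using pow[of 1] m5 x2 by (intro mult_mono) auto
    also have "\<dots> = x ^ 16" unfolding power_add[symmetric] by simp
    also have "\<dots> \<le> exp (16 * s)" using xpow_s[of 16] by simp
    finally have "2 * real m ^ 5 * (real n * d) \<le> exp (16 * s) * (real n * d)"
      by (intro mult_right_mono) (auto simp: d_def)
    also have "\<dots> = real n * (exp (16 * s) * exp (400 * s))" by (simp add: d_def)
    also have "exp (16 * s) * exp (400 * s) = exp (416 * s)" by (simp flip: exp_add)
    also have "real n * exp (416 * s) \<le> real (card E)" using edges by (simp add: s_def y_def x_def)
    finally show "2 * real m ^ 5 * real (card V) * d \<le> real (card E)" by (simp add: n mult.assoc)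
    have "0 < real n * exp (416 * s)" using n by simp
    also have "\<dots> \<le> real (card E)" using edges by (simp add: s_def y_def x_def)
    finally show "E \<noteq> {}" by auto
    have "387 * real L * \<Lambda> \<le> x ^ 9 * x ^ 3 * x ^ 19"
      using pow[of 9] L_x \<Lambda>_x x2 \<Lambda>_pos by (intro mult_mono) auto
    also have "\<dots> = x ^ 31" by (simp flip: power_add)
    finally have "(387 * real L * \<Lambda>) ^ (2 * L) \<le> (x ^ 31) ^ (2 * L)"
      using \<Lambda>_pos by (intro power_mono) auto
    also have "\<dots> = exp (real (62 * L) * y)" by (simp only: xpow[symmetric] power_mult[symmetric]) simp
    also have "\<dots> \<le> exp (248 * s)"
    proof (rule exp_mono)
      have "real L * y \<le> 4 * u * y" using L y by (intro mult_right_mono) auto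
      also have "\<dots> = 4 * s" using su(1) by (metis mult.assoc)
      finally show "real (62 * L) * y \<le> 248 * s" by (simp add: mult_ac)
    qed
    finally have 1: "(387 * real L * \<Lambda>) ^ (2 * L) \<le> exp (248 * s)" .
    have "2592 * \<Lambda> ^ 3 \<le> x ^ 12 * (x ^ 19) ^ 3"
      using pow[of 12] \<Lambda>_x \<Lambda>_pos x2 by (intro mult_mono power_mono) auto
    also have "\<dots> = x ^ 69" by (simp flip: power_add power_mult)
    also have "\<dots> \<le> exp (69 * s)" using xpow_s[of 69] by simp
    finally have "2592 * \<Lambda> ^ 3 * (387 * real L * \<Lambda>) ^ (2 * L) \<le> exp (69 * s) * exp (248 * s)"
      using 1 \<Lambda>_pos by (intro mult_mono) auto
    also have "\<dots> = exp (317 * s)" by (simp flip: exp_add)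
    also have "\<dots> < d" using s_pos by (simp add: d_def)
    finally show "2592 * (12 * real m ^ 5) ^ 3 * (387 * real L * (12 * real m ^ 5)) ^ (2 * L) < d"
      by (simp only: \<Lambda>_def)
    have "256 * \<Lambda>\<^sup>2 * (real L)\<^sup>2 \<le> x ^ 8 * (x ^ 19)\<^sup>2 * (x ^ 3)\<^sup>2"
      using pow[of 8] \<Lambda>_x L_x \<Lambda>_pos x2 by (intro mult_mono power_mono) auto
    also have "\<dots> = x ^ 52" by (simp flip: power_add power_mult)
    also have "\<dots> \<le> exp (52 * s)" using xpow_s[of 52] by simp
    finally have 2: "256 * \<Lambda>\<^sup>2 * (real L)\<^sup>2 \<le> exp (52 * s)" .
    have "exp (348 * s) = d / exp (52 * s)" by (simp add: d_def flip: exp_diff)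
    also have "\<dots> \<le> d / (256 * \<Lambda>\<^sup>2 * (real L)\<^sup>2)"
      using 2 \<Lambda>_pos L by (intro divide_left_mono) (auto simp: d_def)
    finally have "exp (348 * s) ^ L \<le> (d / (256 * \<Lambda>\<^sup>2 * (real L)\<^sup>2)) ^ L"
      by (intro power_mono) auto
    moreover have "(real n)\<^sup>2 < exp (348 * s) ^ L"
    proof -
      have "real n = exp x" using n by (simp add: x_def)
      then have "(real n)\<^sup>2 = exp (2 * x)" by (simp add: power2_eq_square flip: exp_add)
      also have "\<dots> < exp (696 * x)" using x2 by simp
      also have "696 * x = 348 * (s * (2 * u))" using su by simp
      also have "exp \<dots> \<le> exp (348 * (s * L))"
        using L(1) s_pos by (intro exp_mono mult_left_mono) auto
      also have "\<dots> = exp (348 * s) ^ L" by (simp add: mult_ac flip: exp_of_nat_mult)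
      finally show ?thesis .
    qed
    ultimately show "(real (card V))\<^sup>2 < (d / (256 * (12 * real m ^ 5)\<^sup>2 * (real L)\<^sup>2)) ^ L"
      unfolding \<Lambda>_def n by linarith
  qed
qed

section \<open>All n at least 3, and the asymptotic form\<close>

definition growth :: "nat \<Rightarrow> real" where "growth n = sqrt (ln (real n) * ln (ln (real n)))"

lemma ln_gt_one: "n \<ge> 3 \<Longrightarrow> ln (real n) > 1"
proof -
  assume "n \<ge> 3"
  have "exp 1 < real n" using e_less_272 \<open>n \<ge> 3\<close> by simp
  then show ?thesis using \<open>n \<ge> 3\<close> by (metis exp_less_cancel_iff exp_ln less_trans exp_gt_zero)
qed

lemma growth_mono: assumes "3 \<le> k" "k \<le> n" shows "growth k \<le> growth n"
proof -
  have k: "ln (real k) > 1" using assms by (intro ln_gt_one)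
  have kn: "ln (real k) \<le> ln (real n)" using assms by (subst ln_le_cancel_iff) auto
  then have "ln (ln (real k)) \<le> ln (ln (real n))" using k by (subst ln_le_cancel_iff) auto
  moreover have "ln (ln (real k)) > 0" using k by simp
  ultimately show ?thesis
    unfolding growth_def using k kn by (intro real_sqrt_le_mono mult_mono) auto
qed

lemma growth_pos: assumes "n \<ge> 3" shows "growth n > 0"
  using ln_gt_one[OF assms] by (auto simp: growth_def intro!: mult_pos_pos)

text \<open>416 serves n at least 16. For smaller n the trivial bound 2^16 on the number of edges is
  at most exp(16), and monotonicity of \<open>growth\<close> reduces to n = 3.\<close>

definition growth_const :: real where "growth_const = max 416 (16 / growth 3)"

lemma card_le_of_no_regular_sub:
  assumes graph: "linear_3graph V E" and n: "card V = n" "n \<ge> 3" and no: "\<not> has_regular_sub 2 E"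
  shows "real (card E) \<le> real n * exp (growth_const * growth n)"
proof (cases "n \<ge> 16")
  case True
  have "real (card E) \<le> real n * exp (416 * growth n)"
    using regular_sub_of_large_graph[OF graph n(1) True] no by (force simp: growth_def)
  also have "\<dots> \<le> real n * exp (growth_const * growth n)"
    using growth_pos[OF n(2)] by (intro mult_left_mono exp_mono mult_right_mono) (auto simp: growth_const_def)
  finally show ?thesis .
next
  case False
  have finV: "finite V" and "E \<subseteq> Pow V"
    using graph by (auto simp: linear_3graph_def hypergraph_def)
  then have "card E \<le> card (Pow V)" by (intro card_mono) auto
  also have "\<dots> = 2 ^ n" using finV n by (simp add: card_Pow)
  also have "\<dots> \<le> 2 ^ 16" using False by (intro power_increasing) auto
  finally have "real (card E) \<le> real (2 ^ 16)" by (simp only: of_nat_le_iff)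
  also have "\<dots> \<le> exp 1 ^ 16"
  proof -
    have "(2::real) ^ 16 \<le> exp 1 ^ 16" using exp_ge_add_one_self[of 1] by (intro power_mono) auto
    then show ?thesis by simp
  qed
  also have "\<dots> = exp 16" by (simp flip: exp_of_nat_mult)
  also have "\<dots> \<le> exp (growth_const * growth n)"
  proof (rule exp_mono)
    have "16 = 16 / growth 3 * growth 3" using growth_pos[of 3] by simp
    also have "\<dots> \<le> growth_const * growth n"
      using growth_pos[of 3] growth_mono[of 3 n] n by (intro mult_mono) (auto simp: growth_const_def)
    finally show "16 \<le> growth_const * growth n" .
  qed
  also have "\<dots> \<le> real n * exp (growth_const * growth n)"
    using n mult_right_mono[of 1 "real n" "exp (growth_const * growth n)"] by simp
  finally show ?thesis .
qed

theorem theorem1p1: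
  "(\<exists>C::real. \<forall>n::nat. n \<ge> 3 \<longrightarrow>
      real (max_edges n) \<le> real n * exp (C * sqrt (ln (real n) * ln (ln (real n)))))
   \<and> (\<exists>\<epsilon>::nat \<Rightarrow> real. \<epsilon> \<longlonglongrightarrow> 0 \<and>
        (\<forall>n\<ge>1. \<forall>(V::'a set) E.
           linear_3graph V E \<and> card V = n \<and> real (card E) \<ge> real n powr (1 + \<epsilon> n)
             \<longrightarrow> has_regular_sub 2 E))"
proof
  have "real (max_edges n) \<le> real n * exp (growth_const * growth n)" if n: "n \<ge> 3" for n
  proof -
    obtain V :: "nat set" and E where "max_edges n = card E" "card V = n" "linear_3graph V E"
      "\<not> has_regular_sub 2 E"
      using max_edges_attained[of n] by (auto simp: edge_counts_def)
    then show ?thesis using card_le_of_no_regular_sub[of V E n] n by simp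
  qed
  then show "\<exists>C::real. \<forall>n::nat. n \<ge> 3 \<longrightarrow>
      real (max_edges n) \<le> real n * exp (C * sqrt (ln (real n) * ln (ln (real n))))"
    unfolding growth_def by blast
next
  \<comment> \<open>Chosen so that \<open>\<epsilon> n * ln n\<close> is
    \<open>growth_const + 1\<close> times \<open>growth n\<close>; the extra 1 makes the edge count
    strictly exceed the bound for graphs without a 2-regular subhypergraph.\<close>
  define \<epsilon> where "\<epsilon> n = (growth_const + 1) * sqrt (ln (ln (real n)) / ln (real n))" for n
  have "(\<lambda>n. ln (ln (real n)) / ln (real n)) \<longlonglongrightarrow> 0"
    by (rule filterlim_compose[OF ln_x_over_x_tendsto_0
          filterlim_compose[OF ln_at_top filterlim_real_sequentially]])
  then have "(\<lambda>n. (growth_const + 1) * sqrt (ln (ln (real n)) / ln (real n)))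
      \<longlonglongrightarrow> (growth_const + 1) * sqrt 0"
    by (intro tendsto_intros)
  then have "\<epsilon> \<longlonglongrightarrow> 0" unfolding \<epsilon>_def[abs_def] by simp
  moreover have "has_regular_sub 2 E"
    if n: "n \<ge> 1" and graph: "linear_3graph V E" "card V = n"
      and edges: "real (card E) \<ge> real n powr (1 + \<epsilon> n)" for n and V :: "'a set" and E
  proof (cases "n \<ge> 3")
    case True
    define x where "x = ln (real n)"
    have x: "x > 1" using ln_gt_one[OF True] by (simp add: x_def)
    have "sqrt (ln x / x) * x = sqrt (ln x / x) * sqrt (x\<^sup>2)" using x by simp
    also have "\<dots> = sqrt (ln x / x * x\<^sup>2)" by (simp only: real_sqrt_mult)
    also have "ln x / x * x\<^sup>2 = x * ln x" using x by (simp add: power2_eq_square)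
    finally have \<epsilon>: "\<epsilon> n * x = (growth_const + 1) * growth n"
      by (simp add: \<epsilon>_def growth_def x_def)
    have "real n powr (1 + \<epsilon> n) = real n * exp (\<epsilon> n * x)"
      using n by (simp add: powr_def x_def distrib_right exp_add)
    also have "\<dots> > real n * exp (growth_const * growth n)"
      unfolding \<epsilon> using n growth_pos[OF True] by (simp add: algebra_simps)
    finally show ?thesis
      using card_le_of_no_regular_sub[OF graph True] edges by fastforce
  next
    case False
    have "E = {}"
    proof (rule ccontr)
      assume "E \<noteq> {}"
      then obtain e where "e \<in> E" by blast
      then have "e \<subseteq> V" "card e = 3" "finite V"
        using graph by (auto simp: linear_3graph_def hypergraph_def uniform_edges_def)
      then show False using card_mono[of V e] graph(2) False by simp
    qed
    \<comment> \<open>For n below 3 the density hypothesis itself fails: there are no edges, while a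
      power of n is positive.\<close>
    then show ?thesis using edges n by (simp add: not_le)
  qed
  ultimately show "\<exists>\<epsilon>::nat \<Rightarrow> real. \<epsilon> \<longlonglongrightarrow> 0 \<and>
        (\<forall>n\<ge>1. \<forall>(V::'a set) E.
           linear_3graph V E \<and> card V = n \<and> real (card E) \<ge> real n powr (1 + \<epsilon> n)
             \<longrightarrow> has_regular_sub 2 E)"
    by blast
qed

end
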